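(* Let $A:X\supset D(A)\to X$ be a sectorial operator on a real Banach space $X$ such that the resolvents of $A$ are compact, there is an injective linear map $i:X\hookrightarrow H$ into a real Hilbert space $H$, and there is a self-adjoint operator $\widehat A:H\supset D(\widehat A)\to H$ with $(i\times i)[\mathrm{Gr}(A)]\subset \mathrm{Gr}(\widehat A)$. Let $\lambda_1<\lambda_2<\dots$ be the eigenvalues of $A$, let $\lambda=\lambda_k$ for some $k\ge 1$, and let $X_0:=\ker(\lambda I-A)$. Then there are closed subspaces $X_+,X_-$ of $X$ such that $X=X_+\oplus X_-\oplus X_0$ and the following hold. (i) $X_-\subset D(A)$, $A(X_-)\subset X_-$, $A(X_+\cap D(A))\subset X_+$, and $X_-$ is a finite dimensional space such that $X_-=\{0\}$ if $k=1$ and $X_-=\bigoplus_{i=1}^{k-1}\ker(\lambda_iI-A)$ if $k\ge 2$. Hence $\dim X_-=0$ if $k=1$ and $\dim X_-=\sum_{i=1}^{k-1}\dim\ker(\lambda_iI-A)$ if $k\ge 2$. (ii) If $A_+:X_+\supset D(A_+)\to X_+$ and $A_-:X_-\supset D(A_-)\to X_-$ are the parts of $A$ in $X_+$ and $X_-$, respectively, then $\sigma(A_+)=\{\lambda_i\mid i\ge k+1\}$, while $\sigma(A_-)=\emptyset$ if $k=1$ and $\sigma(A_-)=\{\lambda_i\mid i=1,\dots,k-1\}$ if $k\ge 2$. (iii) $\langle i(u_l),i(u_m)\rangle_H=0$ for all $u_l\in X_l$, $u_m\in X_m$ with $l,m\in\{0,-,+\}$, $l\ne m$.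
   Context: $\langle\cdot,\cdot\rangle_H$ is the scalar product of $H$, and $\mathrm{Gr}$ denotes the graph of an operator, so the inclusion of graphs means: if $x\in D(A)$ then $i(x)\in D(\widehat A)$ and $\widehat A\, i(x)=i(Ax)$. For a linear operator $B$ on a real Banach space, $\sigma(B)\subset\mathbb{C}$ is the spectrum of its complexification $B_{\mathbb C}$. Under the hypotheses, $\sigma(A)$ consists of a (finite or infinite) sequence of real eigenvalues; they are enumerated without repetition as $\lambda_1<\lambda_2<\dots$, and if the sequence is infinite then $\lambda_i\to+\infty$. For a linear subspace $Y\subset X$, the part of $A$ in $Y$ is the operator $A_Y$ with $D(A_Y)=\{x\in D(A)\mid Ax\in Y\}$ and $A_Yx=Ax$. *)

theory Defs
  imports "HOL-Analysis.Analysis"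
begin

text \<open>
  An unbounded operator is a pair of a domain \<open>D\<close> and a function \<open>A\<close>; the values of \<open>A\<close> outside
  \<open>D\<close> are irrelevant.
\<close>

definition op_graph :: "'a set \<Rightarrow> ('a \<Rightarrow> 'b) \<Rightarrow> ('a \<times> 'b) set" where
  "op_graph D A = {(x, A x) | x. x \<in> D}"

definition linear_operator :: "'a::real_vector set \<Rightarrow> ('a \<Rightarrow> 'b::real_vector) \<Rightarrow> bool" where
  "linear_operator D A \<longleftrightarrow> subspace D \<and>
     (\<forall>x\<in>D. \<forall>y\<in>D. A (x + y) = A x + A y) \<and> (\<forall>c. \<forall>x\<in>D. A (c *\<^sub>R x) = c *\<^sub>R A x)"


section \<open>Complexification, spectrum, sectorial operators\<close>

text \<open>
  The complexification of a real Banach space \<open>'a\<close> is \<open>'a \<times> 'a\<close>, with \<open>(x, y)\<close> in the role of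
  \<open>x + iy\<close>; the complexification of a subspace \<open>S\<close> is \<open>S \<times> S\<close>, and that of an operator \<open>A\<close> with
  domain \<open>D\<close> is \<open>map_prod A A\<close> with domain \<open>D \<times> D\<close>. The product norm of the library is not
  homogeneous for complex scalars; \<open>cnorm\<close> is the usual (Taylor) norm of the complexification,
  which is equivalent to the product norm, so that both define the same topology.
\<close>

definition cscale :: "complex \<Rightarrow> 'a::real_vector \<times> 'a \<Rightarrow> 'a \<times> 'a" where
  "cscale z w = (Re z *\<^sub>R fst w - Im z *\<^sub>R snd w, Im z *\<^sub>R fst w + Re z *\<^sub>R snd w)"

definition cnorm :: "'a::real_normed_vector \<times> 'a \<Rightarrow> real" where
  "cnorm w = (SUP t::real. norm (cos t *\<^sub>R fst w + sin t *\<^sub>R snd w))"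

lemma bdd_above_cnorm:
  "bdd_above (range (\<lambda>t::real. norm (cos t *\<^sub>R fst w + sin t *\<^sub>R snd w)))"
proof (rule bdd_aboveI2)
  fix t :: real
  have "norm (cos t *\<^sub>R fst w + sin t *\<^sub>R snd w) \<le> \<bar>cos t\<bar> * norm (fst w) + \<bar>sin t\<bar> * norm (snd w)"
    by (metis norm_scaleR norm_triangle_ineq)
  also have "\<dots> \<le> norm (fst w) + norm (snd w)"
    by (intro add_mono mult_left_le_one_le) auto
  finally show "norm (cos t *\<^sub>R fst w + sin t *\<^sub>R snd w) \<le> norm (fst w) + norm (snd w)" .
qed

lemma cnorm_le_norm: "cnorm w \<le> 2 * norm w"
  unfolding cnorm_def
proof (rule cSUP_least)
  fix t :: real
  have "norm (cos t *\<^sub>R fst w + sin t *\<^sub>R snd w) \<le> \<bar>cos t\<bar> * norm (fst w) + \<bar>sin t\<bar> * norm (snd w)"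
    by (metis norm_scaleR norm_triangle_ineq)
  also have "\<dots> \<le> norm (fst w) + norm (snd w)"
    by (intro add_mono mult_left_le_one_le) auto
  also have "\<dots> \<le> 2 * norm w"
    using norm_fst_le[of "fst w" "snd w"] norm_snd_le[of "snd w" "fst w"] by simp
  finally show "norm (cos t *\<^sub>R fst w + sin t *\<^sub>R snd w) \<le> 2 * norm w" .
qed simp

lemma norm_le_cnorm: "norm w \<le> 2 * cnorm w"
proof -
  have "norm (fst w) \<le> cnorm w"
    using cSUP_upper[OF UNIV_I[of 0] bdd_above_cnorm[of w]] by (simp add: cnorm_def)
  moreover have "norm (snd w) \<le> cnorm w"
    using cSUP_upper[OF UNIV_I[of "pi/2"] bdd_above_cnorm[of w]] by (simp add: cnorm_def)
  ultimately show ?thesis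
    using norm_Pair_le[of "fst w" "snd w"] by simp
qed

definition shifted :: "('a::real_vector \<Rightarrow> 'a) \<Rightarrow> complex \<Rightarrow> 'a \<times> 'a \<Rightarrow> 'a \<times> 'a" where
  "shifted A z w = cscale z w - map_prod A A w"

definition resolvent :: "'a::real_vector set \<Rightarrow> ('a \<Rightarrow> 'a) \<Rightarrow> complex \<Rightarrow> 'a \<times> 'a \<Rightarrow> 'a \<times> 'a" where
  "resolvent D A z = inv_into (D \<times> D) (shifted A z)"

text \<open>
  Here \<open>S\<close> is the Banach space (a closed subspace of \<open>'a\<close>) in which the operator acts.
\<close>

definition resolvent_set :: "'a::real_normed_vector set \<Rightarrow> 'a set \<Rightarrow> ('a \<Rightarrow> 'a) \<Rightarrow> complex set" where
  "resolvent_set S D A = {z. bij_betw (shifted A z) (D \<times> D) (S \<times> S) \<and>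
     (\<exists>K. \<forall>w\<in>S \<times> S. cnorm (resolvent D A z w) \<le> K * cnorm w)}"

definition spectrum :: "'a::real_normed_vector set \<Rightarrow> 'a set \<Rightarrow> ('a \<Rightarrow> 'a) \<Rightarrow> complex set" where
  "spectrum S D A = - resolvent_set S D A"

definition sectorial :: "'a::real_normed_vector set \<Rightarrow> ('a \<Rightarrow> 'a) \<Rightarrow> bool" where
  "sectorial D A \<longleftrightarrow> linear_operator D A \<and> closed (op_graph D A) \<and> closure D = UNIV \<and>
     (\<exists>(\<phi>::real) (M::real) (a::real). 0 < \<phi> \<and> \<phi> < pi / 2 \<and> 1 \<le> M \<and>
        (\<forall>z. z \<noteq> of_real a \<and> \<phi> \<le> \<bar>Arg (z - of_real a)\<bar> \<and> \<bar>Arg (z - of_real a)\<bar> \<le> pi \<longrightarrow>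
           z \<in> resolvent_set UNIV D A \<and>
           (\<forall>w. cnorm (resolvent D A z w) \<le> M / cmod (z - of_real a) * cnorm w)))"

definition compact_resolvents :: "'a::real_normed_vector set \<Rightarrow> ('a \<Rightarrow> 'a) \<Rightarrow> bool" where
  "compact_resolvents D A \<longleftrightarrow>
     (\<forall>z\<in>resolvent_set UNIV D A. compact (closure (resolvent D A z ` {w. cnorm w \<le> 1})))"


section \<open>Self-adjoint operators\<close>

definition adjoint_graph :: "'b::real_inner set \<Rightarrow> ('b \<Rightarrow> 'b) \<Rightarrow> ('b \<times> 'b) set" where
  "adjoint_graph D A = {(y, z). \<forall>x\<in>D. inner (A x) y = inner x z}"

definition self_adjoint :: "'b::real_inner set \<Rightarrow> ('b \<Rightarrow> 'b) \<Rightarrow> bool" where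
  "self_adjoint D A \<longleftrightarrow> linear_operator D A \<and> closure D = UNIV \<and> op_graph D A = adjoint_graph D A"


section \<open>Eigenvalues and parts\<close>

definition eigenspace :: "'a::real_vector set \<Rightarrow> ('a \<Rightarrow> 'a) \<Rightarrow> real \<Rightarrow> 'a set" where
  "eigenspace D A \<mu> = {x \<in> D. \<mu> *\<^sub>R x - A x = 0}"

definition eigenvalues :: "'a::real_vector set \<Rightarrow> ('a \<Rightarrow> 'a) \<Rightarrow> real set" where
  "eigenvalues D A = {\<mu>. \<exists>x\<in>D. x \<noteq> 0 \<and> A x = \<mu> *\<^sub>R x}"

text \<open>
  \<open>eigenvalue_nr D A j\<close> is the \<open>j\<close>-th smallest eigenvalue (counted from \<open>1\<close>, without multiplicity);
  \<open>eigenvalue_indices D A\<close> is \<open>{1..N}\<close> if there are exactly \<open>N\<close> eigenvalues, and the set of all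
  positive integers if there are infinitely many.
\<close>

definition nth_smallest :: "real set \<Rightarrow> nat \<Rightarrow> real" where
  "nth_smallest E j = (THE \<mu>. \<mu> \<in> E \<and> finite {\<nu>\<in>E. \<nu> < \<mu>} \<and> card {\<nu>\<in>E. \<nu> < \<mu>} + 1 = j)"

lemma nth_smallest_eqI:
  assumes "\<mu> \<in> E" "finite {\<nu>\<in>E. \<nu> < \<mu>}" "card {\<nu>\<in>E. \<nu> < \<mu>} + 1 = j"
  shows "nth_smallest E j = \<mu>"
  unfolding nth_smallest_def
proof (rule the_equality)
  fix \<xi> assume \<xi>: "\<xi> \<in> E \<and> finite {\<nu>\<in>E. \<nu> < \<xi>} \<and> card {\<nu>\<in>E. \<nu> < \<xi>} + 1 = j"
  have "{\<nu>\<in>E. \<nu> < \<xi>} \<subset> {\<nu>\<in>E. \<nu> < \<mu>}" if "\<xi> < \<mu>" using that \<xi> by auto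
  moreover have "{\<nu>\<in>E. \<nu> < \<mu>} \<subset> {\<nu>\<in>E. \<nu> < \<xi>}" if "\<mu> < \<xi>" using that assms by auto
  ultimately show "\<xi> = \<mu>"
    using psubset_card_mono[of "{\<nu>\<in>E. \<nu> < \<xi>}" "{\<nu>\<in>E. \<nu> < \<mu>}"]
      psubset_card_mono[of "{\<nu>\<in>E. \<nu> < \<mu>}" "{\<nu>\<in>E. \<nu> < \<xi>}"] assms \<xi>
    by (cases \<xi> \<mu> rule: linorder_cases) auto
qed (use assms in auto)

text \<open>
  Whenever a set of reals is listed in increasing order without repetition, the list is the one
  given by \<open>nth_smallest\<close>.
\<close>

lemma nth_smallest_enumeration:
  assumes mono: "strict_mono_on I f" and E: "f ` I = E" and I: "I = {1..N} \<or> I = {1..}"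
    and j: "j \<in> I"
  shows "nth_smallest E j = f j"
proof (rule nth_smallest_eqI)
  have eq: "{\<nu>\<in>E. \<nu> < f j} = f ` {1..<j}"
  proof -
    have "f i < f j \<longleftrightarrow> i < j" if "i \<in> I" for i
      using strict_mono_on_less[OF mono] that j by blast
    moreover have "{1..<j} = {i\<in>I. i < j}" using I j by auto
    ultimately show ?thesis using E by auto
  qed
  have "inj_on f {1..<j}"
  proof (rule inj_on_subset[OF strict_mono_on_imp_inj_on[OF mono]])
    show "{1..<j} \<subseteq> I" using I j by auto
  qed
  then show "finite {\<nu>\<in>E. \<nu> < f j}" "card {\<nu>\<in>E. \<nu> < f j} + 1 = j"
    unfolding eq using I j by (auto simp: card_image)
  show "f j \<in> E" using E j by auto
qed

definition eigenvalue_nr :: "'a::real_vector set \<Rightarrow> ('a \<Rightarrow> 'a) \<Rightarrow> nat \<Rightarrow> real" where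
  "eigenvalue_nr D A j = nth_smallest (eigenvalues D A) j"

definition eigenvalue_indices :: "'a::real_vector set \<Rightarrow> ('a \<Rightarrow> 'a) \<Rightarrow> nat set" where
  "eigenvalue_indices D A =
     {j. 1 \<le> j \<and> (finite (eigenvalues D A) \<longrightarrow> j \<le> card (eigenvalues D A))}"

text \<open>
  The part of \<open>A\<close> in \<open>Y\<close> is the restriction of \<open>A\<close> to \<open>part_domain D A Y\<close>. Since it is an operator
  in the space \<open>Y\<close>, its domain consists of elements of \<open>Y\<close>.
\<close>

definition part_domain :: "'a set \<Rightarrow> ('a \<Rightarrow> 'a) \<Rightarrow> 'a set \<Rightarrow> 'a set" where
  "part_domain D A Y = {x \<in> D \<inter> Y. A x \<in> Y}"


section \<open>Direct sums\<close>

definition direct_sum :: "'i set \<Rightarrow> ('i \<Rightarrow> 'a::real_vector set) \<Rightarrow> 'a set \<Rightarrow> bool" where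
  "direct_sum I V W \<longleftrightarrow> bij_betw (\<lambda>v. \<Sum>j\<in>I. v j) (Pi\<^sub>E I V) W"

definition direct_sum3 :: "'a::real_vector set \<Rightarrow> 'a set \<Rightarrow> 'a set \<Rightarrow> 'a set \<Rightarrow> bool" where
  "direct_sum3 U V W Z \<longleftrightarrow> bij_betw (\<lambda>(u, v, w). u + v + w) (U \<times> V \<times> W) Z"

text \<open>The library's \<open>dim\<close> is \<open>0\<close> on infinite dimensional spaces.\<close>

definition finite_dimensional :: "'a::real_vector set \<Rightarrow> bool" where
  "finite_dimensional V \<longleftrightarrow> (\<exists>B. finite B \<and> V = span B)"

end

theory Submission
  imports Defs
begin

text \<open>
  Pick a real point \<open>\<mu>\<^sub>0\<close> of the resolvent set and let \<open>R\<close> be the inverse of \<open>\<mu>\<^sub>0 I - A\<close>, a compact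
  operator. Pulled back along \<open>i\<close>, the inner product of the Hilbert space becomes a positive definite
  form on the Banach space for which \<open>A\<close> and \<open>R\<close> are symmetric, so eigenspaces for different
  eigenvalues are orthogonal. The subspaces are \<open>X\<^sub>-\<close>, the span of the eigenspaces below \<open>\<lambda>\<^sub>k\<close>, and \<open>X\<^sub>+\<close>,
  the orthogonal complement of all eigenspaces up to \<open>\<lambda>\<^sub>k\<close>.

  The difficulty is that \<open>i\<close> is not assumed to be continuous, so it is not clear that \<open>X\<^sub>+\<close> is closed or
  that the orthogonal projections are continuous. Compactness supplies this. The eigenspace of a real
  number \<open>\<nu>\<close> is the kernel of \<open>I - (\<mu>\<^sub>0 - \<nu>) R\<close>, whose range is closed by Riesz theory and orthogonal to
  the kernel by symmetry. Applied on this range, the Fredholm alternative shows that kernel and range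
  together span the space (\<open>eig_perp_split\<close>), and that the range is exactly the orthogonal complement
  of the eigenspace (\<open>perp_eq_range\<close>).

  The same argument gives discreteness: \<open>I - (\<mu>\<^sub>0 - \<nu>) R\<close> is bounded below on that complement, where
  the eigenvectors for all other eigenvalues lie, so no eigenvalue different from \<open>\<nu>\<close> is near \<open>\<nu>\<close>
  (\<open>not_islimpt_eigenvalues\<close>). As the sector bounds the eigenvalues from below, they can be enumerated.

  For the spectra, let \<open>S\<close> be any closed \<open>R\<close>-invariant subspace. On the complexification of \<open>S\<close> the
  operator \<open>z I - A\<close> becomes, after composition with \<open>R\<close>, again a compact perturbation of the identity,
  so it has a bounded inverse as soon as it is injective; by symmetry its kernel is trivial unless \<open>z\<close>
  is a real eigenvalue with an eigenvector in \<open>S\<close> (\<open>spectrum_part\<close>). It remains to see which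
  eigenvectors lie in \<open>X\<^sub>+\<close> and \<open>X\<^sub>-\<close>, and orthogonality answers that.
\<close>

section \<open>Compact operators\<close>

text \<open>
  The sequential form of compactness is chosen because the proofs below only ever extract convergent
  subsequences; it passes to composites and to the complexification \<open>map_prod K K\<close> directly.
\<close>

definition compact_op :: "('a::real_normed_vector \<Rightarrow> 'b::real_normed_vector) \<Rightarrow> bool" where
  "compact_op K \<longleftrightarrow> bounded_linear K \<and>
     (\<forall>x::nat \<Rightarrow> 'a. bounded (range x) \<longrightarrow>
        (\<exists>r l. strict_mono (r::nat \<Rightarrow> nat) \<and> (\<lambda>n. K (x (r n))) \<longlonglongrightarrow> l))"

lemma compact_op_bounded_linear: "compact_op K \<Longrightarrow> bounded_linear K"
  by (simp add: compact_op_def)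

lemma compact_op_subseq:
  fixes x :: "nat \<Rightarrow> 'a::real_normed_vector"
  assumes "compact_op K" "bounded (range x)"
  obtains r l where "strict_mono r" "(\<lambda>n. K (x (r n))) \<longlonglongrightarrow> l"
  using assms unfolding compact_op_def by blast

text \<open>
  This converts relative compactness of the image of a ball, the form in which compact resolvents
  are given, into subsequences: a bounded sequence is first scaled into the ball.
\<close>

lemma compact_opI:
  assumes K: "bounded_linear K" and e: "0 < e" and C: "compact C" and sub: "K ` cball 0 e \<subseteq> C"
  shows "compact_op K"
  unfolding compact_op_def
proof (intro conjI allI impI K)
  interpret K: bounded_linear K by (rule K)
  fix x :: "nat \<Rightarrow> 'a" assume "bounded (range x)"
  then obtain b where b: "0 < b" "\<And>n. norm (x n) \<le> b"
    by (metis bounded_pos rangeI)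
  have "\<forall>n. K ((e / b) *\<^sub>R x n) \<in> C"
  proof
    fix n
    have "norm ((e / b) *\<^sub>R x n) \<le> e"
      using b e mult_left_mono[OF b(2)[of n], of e] by (simp add: divide_simps)
    then show "K ((e / b) *\<^sub>R x n) \<in> C" using sub by (auto simp: image_subset_iff)
  qed
  then obtain r l where r: "strict_mono r" "((\<lambda>n. K ((e / b) *\<^sub>R x n)) \<circ> r) \<longlonglongrightarrow> l"
    using C[unfolded compact_eq_seq_compact_metric] by (meson seq_compactE)
  have "(\<lambda>n. (b / e) *\<^sub>R K ((e / b) *\<^sub>R x (r n))) \<longlonglongrightarrow> (b / e) *\<^sub>R l"
    using r(2) by (intro tendsto_intros) (simp add: o_def)
  then have "(\<lambda>n. K (x (r n))) \<longlonglongrightarrow> (b / e) *\<^sub>R l"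
    using b(1) e by (simp add: K.scaleR)
  then show "\<exists>r l. strict_mono r \<and> (\<lambda>n. K (x (r n))) \<longlonglongrightarrow> l" using r(1) by blast
qed

lemma compact_op_compose:
  fixes K :: "'a::real_normed_vector \<Rightarrow> 'b::real_normed_vector"
    and L :: "'b \<Rightarrow> 'd::real_normed_vector" and M :: "'c::real_normed_vector \<Rightarrow> 'a"
  assumes K: "compact_op K" and L: "bounded_linear L" and M: "bounded_linear M"
  shows "compact_op (\<lambda>x. L (K (M x)))"
  unfolding compact_op_def
proof (intro conjI allI impI)
  show "bounded_linear (\<lambda>x. L (K (M x)))"
    using bounded_linear_compose[OF L bounded_linear_compose[OF compact_op_bounded_linear[OF K] M]] .
  fix x :: "nat \<Rightarrow> 'c" assume "bounded (range x)"
  then have "bounded (range (\<lambda>n. M (x n)))"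
    using bounded_linear_image[OF _ M] by (metis image_image)
  then obtain r l where "strict_mono r" "(\<lambda>n. K (M (x (r n)))) \<longlonglongrightarrow> l"
    by (rule compact_op_subseq[OF K])
  then show "\<exists>r l. strict_mono r \<and> (\<lambda>n. L (K (M (x (r n))))) \<longlonglongrightarrow> l"
    using bounded_linear.tendsto[OF L] by blast
qed

lemma compact_op_map_prod:
  assumes K: "compact_op K"
  shows "compact_op (map_prod K K)"
  unfolding compact_op_def
proof (intro conjI allI impI)
  have bl: "bounded_linear K" by (rule compact_op_bounded_linear[OF K])
  have eq: "map_prod K K = (\<lambda>w. (K (fst w), K (snd w)))" by (auto simp: fun_eq_iff)
  show "bounded_linear (map_prod K K)" unfolding eq
    by (intro bounded_linear_Pair bounded_linear_compose[OF bl] bounded_linear_fst bounded_linear_snd)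
  fix x :: "nat \<Rightarrow> 'a \<times> 'a" assume b: "bounded (range x)"
  have "bounded (range (\<lambda>n. fst (x n)))" "bounded (range (\<lambda>n. snd (x n)))"
    using bounded_fst[OF b] bounded_snd[OF b] by (simp_all add: image_image)
  then obtain r l where r: "strict_mono r" "(\<lambda>n. K (fst (x (r n)))) \<longlonglongrightarrow> l"
    using compact_op_subseq[OF K] by blast
  have "bounded (range (\<lambda>n. snd (x (r n))))"
    using \<open>bounded (range (\<lambda>n. snd (x n)))\<close> by (rule bounded_subset) auto
  then obtain s m where s: "strict_mono s" "(\<lambda>n. K (snd (x (r (s n))))) \<longlonglongrightarrow> m"
    by (rule compact_op_subseq[OF K])
  have "(\<lambda>n. K (fst (x (r (s n))))) \<longlonglongrightarrow> l"
    using LIMSEQ_subseq_LIMSEQ[OF r(2) s(1)] by (simp add: o_def)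
  then have "(\<lambda>n. map_prod K K (x ((r \<circ> s) n))) \<longlonglongrightarrow> (l, m)"
    unfolding eq using s(2) by (auto intro: tendsto_Pair)
  then show "\<exists>r l. strict_mono r \<and> (\<lambda>n. map_prod K K (x (r n))) \<longlonglongrightarrow> l"
    using strict_mono_o[OF r(1) s(1)] by blast
qed

section \<open>Riesz's lemma and finite dimensional subspaces\<close>

lemma almost_nearest_point:
  fixes M :: "'a::metric_space set"
  assumes M: "closed M" "M \<noteq> {}" and x: "x \<notin> M"
  obtains m where "0 < infdist x M" "m \<in> M" "dist x m < 2 * infdist x M"
proof -
  have d: "0 < infdist x M"
    using in_closed_iff_infdist_zero[OF M, of x] x infdist_nonneg[of x M] by simp
  have "\<exists>m\<in>M. dist x m < 2 * infdist x M"
  proof (rule ccontr)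
    assume "\<not> ?thesis"
    then have "2 * infdist x M \<le> infdist x M" using M(2)
      by (subst (2) infdist_notempty) (auto simp: not_less intro!: cINF_greatest)
    with d show False by simp
  qed
  with d that show ?thesis by blast
qed

text \<open>
  Riesz's lemma. Normalising \<open>x - m\<close> for a point \<open>m\<close> of \<open>M\<close> that is nearest to \<open>x\<close> up to the
  factor 2 gives \<open>u\<close>.
\<close>

lemma riesz_almost_orthogonal:
  fixes M T :: "'a::real_normed_vector set"
  assumes M: "closed M" "subspace M" and T: "subspace T" "M \<subseteq> T" and x: "x \<in> T" "x \<notin> M"
  obtains u where "u \<in> T" "norm u = 1" "\<And>m. m \<in> M \<Longrightarrow> 1 / 2 \<le> norm (u - m)"
proof -
  have ne: "M \<noteq> {}" using subspace_0[OF M(2)] by auto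
  define d where "d = infdist x M"
  obtain m where m: "m \<in> M" "norm (x - m) < 2 * d"
    using almost_nearest_point[OF M(1) ne x(2)] by (auto simp: dist_norm d_def)
  define r where "r = norm (x - m)"
  have r: "0 < r" using m x by (auto simp: r_def)
  show ?thesis
  proof
    show "(1 / r) *\<^sub>R (x - m) \<in> T"
      using m T x by (auto intro!: subspace_scale subspace_diff)
    show "norm ((1 / r) *\<^sub>R (x - m)) = 1" using r by (simp add: r_def)
    fix v assume "v \<in> M"
    then have "m + r *\<^sub>R v \<in> M" using M(2) m(1) by (simp add: subspace_add subspace_scale)
    then have "d \<le> norm (x - (m + r *\<^sub>R v))"
      using infdist_le[of "m + r *\<^sub>R v" M x] by (simp add: d_def dist_norm)
    also have "x - (m + r *\<^sub>R v) = r *\<^sub>R ((1 / r) *\<^sub>R (x - m) - v)"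
      using r by (simp add: algebra_simps)
    also have "norm \<dots> = r * norm ((1 / r) *\<^sub>R (x - m) - v)" using r by (simp add: abs_of_pos)
    finally have "r / 2 \<le> r * norm ((1 / r) *\<^sub>R (x - m) - v)"
      using m(2) by (simp add: r_def)
    then show "1 / 2 \<le> norm ((1 / r) *\<^sub>R (x - m) - v)"
      using r by (simp add: field_simps)
  qed
qed

text \<open>
  The coefficient of \<open>v\<close> is bounded by the norm divided by the distance of \<open>v\<close> to \<open>M\<close>. Hence the
  coefficients of a convergent sequence converge, and so do the components in \<open>M\<close>.
\<close>

lemma closed_span_insert:
  fixes M :: "'a::real_normed_vector set"
  assumes M: "closed M" "subspace M"
  shows "closed (span (insert v M))"
proof (cases "v \<in> M")
  case True
  then show ?thesis using M by (simp add: insert_absorb span_eq_iff[THEN iffD2])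
next
  case False
  have ne: "M \<noteq> {}" using subspace_0[OF M(2)] by auto
  define d where "d = infdist v M"
  have d: "0 < d" using almost_nearest_point[OF M(1) ne False] unfolding d_def by blast
  have bound: "\<bar>t\<bar> * d \<le> norm (t *\<^sub>R v + m)" if "m \<in> M" for t m
  proof (cases "t = 0")
    case False
    have "(- 1 / t) *\<^sub>R m \<in> M" using that M(2) by (rule subspace_scale[rotated])
    then have "d \<le> norm (v - (- 1 / t) *\<^sub>R m)"
      using infdist_le[of "(- 1 / t) *\<^sub>R m" M v] by (simp only: d_def dist_norm)
    then have "\<bar>t\<bar> * d \<le> \<bar>t\<bar> * norm (v - (- 1 / t) *\<^sub>R m)" by (simp add: mult_left_mono)
    also have "\<dots> = norm (t *\<^sub>R (v - (- 1 / t) *\<^sub>R m))" by simp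
    also have "t *\<^sub>R (v - (- 1 / t) *\<^sub>R m) = t *\<^sub>R v + m" using False by (simp add: algebra_simps)
    finally show ?thesis .
  qed simp
  have span: "span (insert v M) = {x. \<exists>t. x - t *\<^sub>R v \<in> M}"
    using M(2) by (simp add: span_insert span_eq_iff[THEN iffD2])
  show ?thesis
  proof (subst closed_sequential_limits, intro allI impI, elim conjE)
    fix x l assume x: "\<forall>n. x n \<in> span (insert v M)" "x \<longlonglongrightarrow> l"
    then obtain t where t: "\<And>n. x n - t n *\<^sub>R v \<in> M" unfolding span by auto metis
    have "Cauchy t"
    proof (rule CauchyI)
      fix e :: real assume e: "0 < e"
      then obtain n0 where n0: "\<And>m n. n0 \<le> m \<Longrightarrow> n0 \<le> n \<Longrightarrow> norm (x m - x n) < e * d"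
        using CauchyD[OF LIMSEQ_imp_Cauchy[OF x(2)], of "e * d"] d by (meson mult_pos_pos)
      show "\<exists>n0. \<forall>m\<ge>n0. \<forall>n\<ge>n0. norm (t m - t n) < e"
      proof (intro exI allI impI)
        fix m n assume mn: "n0 \<le> m" "n0 \<le> n"
        have "(x m - t m *\<^sub>R v) - (x n - t n *\<^sub>R v) \<in> M" using t M(2) by (simp add: subspace_diff)
        from bound[OF this, of "t m - t n"]
        have "\<bar>t m - t n\<bar> * d \<le> norm (x m - x n)" by (simp add: algebra_simps)
        also have "\<dots> < e * d" using n0 mn by blast
        finally show "norm (t m - t n) < e" using d by simp
      qed
    qed
    then obtain s where "t \<longlonglongrightarrow> s" by (auto simp: convergent_eq_Cauchy[symmetric])
    then have lim: "(\<lambda>n. x n - t n *\<^sub>R v) \<longlonglongrightarrow> l - s *\<^sub>R v"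
      by (intro tendsto_intros x(2))
    have "l - s *\<^sub>R v \<in> M" using closed_sequentially[OF M(1) _ lim] t by blast
    then show "l \<in> span (insert v M)" unfolding span by auto
  qed
qed

lemma closed_span_finite:
  fixes B :: "'a::real_normed_vector set"
  assumes "finite B"
  shows "closed (span B)"
  using assms
proof induction
  case (insert v B)
  have "span (insert v (span B)) = span (insert v B)"
  proof (rule antisym)
    show "span (insert v (span B)) \<subseteq> span (insert v B)"
      by (intro span_minimal subspace_span)
        (auto intro: span_base span_mono[THEN subsetD, of B])
    show "span (insert v B) \<subseteq> span (insert v (span B))"
      by (intro span_mono) (auto intro: span_base)
  qed
  then show ?case using closed_span_insert[OF insert.IH subspace_span, of v] by simp
qed simp

section \<open>Riesz theory of compact perturbations of the identity\<close>

text \<open>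
  If there were no such \<open>c\<close>, unit vectors \<open>x n\<close> in \<open>S\<close> would satisfy \<open>x n - K (x n) \<longlonglongrightarrow> 0\<close>; a limit
  point of \<open>K (x n)\<close> would then be a unit vector of \<open>S\<close> fixed by \<open>K\<close>.
\<close>

lemma compact_perturbation_bounded_below:
  fixes K :: "'a::real_normed_vector \<Rightarrow> 'a"
  assumes K: "compact_op K" and S: "closed S" "subspace S"
    and inj: "\<And>x. x \<in> S \<Longrightarrow> x - K x = 0 \<Longrightarrow> x = 0"
  obtains c where "0 < c" "\<And>x. x \<in> S \<Longrightarrow> c * norm x \<le> norm (x - K x)"
proof -
  interpret K: bounded_linear K by (rule compact_op_bounded_linear[OF K])
  have "\<exists>c>0. \<forall>x\<in>S. c * norm x \<le> norm (x - K x)"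
  proof (rule ccontr)
    assume neg: "\<not> ?thesis"
    have "\<exists>x\<in>S. norm x = 1 \<and> norm (x - K x) < 1 / Suc n" for n
    proof -
      obtain x where x: "x \<in> S" "norm (x - K x) < (1 / Suc n) * norm x"
        using neg by (meson not_le of_nat_0_less_iff zero_less_Suc zero_less_divide_1_iff)
      then have "x \<noteq> 0" by auto
      have "(1 / norm x) *\<^sub>R x - K ((1 / norm x) *\<^sub>R x) = (1 / norm x) *\<^sub>R (x - K x)"
        by (simp add: K.scaleR scaleR_diff_right)
      then have "norm ((1 / norm x) *\<^sub>R x - K ((1 / norm x) *\<^sub>R x)) = norm (x - K x) / norm x"
        by (simp only: norm_scaleR) simp
      also have "\<dots> < 1 / Suc n"
        using x(2) \<open>x \<noteq> 0\<close> by (simp add: field_simps)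
      finally have "norm ((1 / norm x) *\<^sub>R x - K ((1 / norm x) *\<^sub>R x)) < 1 / Suc n" .
      
      then show ?thesis using x(1) \<open>x \<noteq> 0\<close> S(2)
        by (intro bexI[of _ "(1 / norm x) *\<^sub>R x"]) (auto simp: subspace_scale)
    qed
    then obtain x where x: "\<And>n. x n \<in> S" "\<And>n. norm (x n) = 1"
        "\<And>n. norm (x n - K (x n)) < 1 / Suc n" by metis
    have "bounded (range x)" using x(2) by (auto simp: bounded_iff)
    then obtain r l where r: "strict_mono r" "(\<lambda>n. K (x (r n))) \<longlonglongrightarrow> l"
      by (rule compact_op_subseq[OF K])
    have "(\<lambda>n. x n - K (x n)) \<longlonglongrightarrow> 0"
      using x(3) by (intro LIMSEQ_norm_0)  auto
    then have d: "(\<lambda>n. x (r n) - K (x (r n))) \<longlonglongrightarrow> 0"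
      using LIMSEQ_subseq_LIMSEQ[OF _ r(1)] by (force simp: o_def)
    from tendsto_add[OF d r(2)] have xl: "(\<lambda>n. x (r n)) \<longlonglongrightarrow> l" by simp
    have "(\<lambda>n. x (r n) - K (x (r n))) \<longlonglongrightarrow> l - K l"
      by (intro tendsto_diff xl K.tendsto)
    then have "l - K l = 0" using d LIMSEQ_unique by blast
    moreover have "l \<in> S" using closed_sequentially[OF S(1) _ xl] x(1) by blast
    ultimately have "l = 0" using inj by blast
    then show False using tendsto_norm[OF xl] x(2) by (simp add: LIMSEQ_const_iff)
  qed
  then show ?thesis using that by blast
qed

text \<open>
  If \<open>I - K\<close> were injective but not surjective on \<open>S\<close>, the ranges of its powers would form a strictly
  decreasing chain of closed subspaces, and Riesz's lemma would give unit vectors, one in each step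
  of the chain, whose images under \<open>K\<close> are at mutual distance at least \<open>1 / 2\<close>. The statement is for
  an invariant closed subspace \<open>S\<close> because it is applied to ranges of \<open>I - K\<close> and to the summands of
  the decomposition.
\<close>

lemma fredholm_alternative:
  fixes K :: "'a::banach \<Rightarrow> 'a"
  assumes K: "compact_op K" and S: "closed S" "subspace S" and inv: "K ` S \<subseteq> S"
    and inj: "\<And>x. x \<in> S \<Longrightarrow> x - K x = 0 \<Longrightarrow> x = 0"
  shows "(\<lambda>x. x - K x) ` S = S"
proof (rule ccontr)
  assume neg: "(\<lambda>x. x - K x) ` S \<noteq> S"
  interpret K: bounded_linear K by (rule compact_op_bounded_linear[OF K])
  define f where "f x = x - K x" for x
  have f: "bounded_linear f" unfolding f_def
    by (intro bounded_linear_sub bounded_linear_ident K.bounded_linear_axioms)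
  interpret f: bounded_linear f by (rule f)
  obtain c where c: "0 < c" "\<And>x. x \<in> S \<Longrightarrow> c * norm x \<le> norm (f x)"
    using compact_perturbation_bounded_below[OF K S inj] unfolding f_def by blast
  have fS: "f x \<in> S" if "x \<in> S" for x
    using that inv S(2) by (auto simp: f_def intro: subspace_diff)
  have inj_f: "x = y" if "x \<in> S" "y \<in> S" "f x = f y" for x y
    using inj[of "x - y"] that S(2) f.diff[of x y] by (auto simp: f_def subspace_diff)
  define T where "T n = (f ^^ n) ` S" for n
  have T_Suc: "T (Suc n) = f ` T n" for n by (auto simp: T_def image_comp)
  have T: "complete (T n) \<and> subspace (T n) \<and> T n \<subseteq> S" for n
  proof (induction n)
    case 0
    then show ?case using S by (simp add: T_def complete_eq_closed)
  next
    case (Suc n)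
    have "complete (f ` T n)"
      using Suc c by (intro complete_isometric_image[OF c(1) _ f]) auto
    moreover have "subspace (f ` T n)"
      using Suc f.linear_axioms by (blast intro: linear_subspace_image)
    ultimately show ?case using Suc fS by (auto simp: T_Suc)
  qed
  have dec: "T (Suc n) \<subseteq> T n" for n
  proof (induction n)
    case 0
    then show ?case using fS by (auto simp: T_def)
  next
    case (Suc n)
    then show ?case by (auto simp: T_Suc)
  qed
  have mono: "T m \<subseteq> T n" if "n \<le> m" for m n
    using lift_Suc_antimono_le[of T n m] dec that by blast
  obtain y where y: "y \<in> S" "y \<notin> f ` S" using neg fS unfolding f_def by blast
  have y_n: "(f ^^ n) y \<in> T n - T (Suc n)" for n
  proof (induction n)
    case 0
    then show ?case using y by (auto simp: T_def)
  next
    case (Suc n)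
    then have "(f ^^ Suc n) y \<in> T (Suc n)" by (auto simp: T_Suc)
    moreover have "(f ^^ Suc n) y \<notin> T (Suc (Suc n))"
    proof
      assume "(f ^^ Suc n) y \<in> T (Suc (Suc n))"
      then obtain u where u: "u \<in> T (Suc n)" "f ((f ^^ n) y) = f u" by (auto simp: T_Suc[of "Suc n"])
      then have "(f ^^ n) y = u" using inj_f Suc T by blast
      then show False using Suc u by blast
    qed
    ultimately show ?case by blast
  qed
  have "\<exists>u. u \<in> T n \<and> norm u = 1 \<and> (\<forall>m\<in>T (Suc n). 1 / 2 \<le> norm (u - m))" for n
    using riesz_almost_orthogonal[of "T (Suc n)" "T n" "(f ^^ n) y"] T[of n] T[of "Suc n"] dec[of n] y_n[of n]
    by (metis DiffE complete_imp_closed)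
  then obtain u where u: "\<And>n. u n \<in> T n" "\<And>n. norm (u n) = 1"
      "\<And>n m. m \<in> T (Suc n) \<Longrightarrow> 1 / 2 \<le> norm (u n - m)" by metis
  have sep: "1 / 2 \<le> norm (K (u n) - K (u m))" if "n < m" for n m
  proof -
    have "f (u n) \<in> T (Suc n)" using u(1)[of n] by (auto simp: T_Suc)
    moreover have "u m \<in> T (Suc n)" using u(1)[of m] mono[of "Suc n" m] that by auto
    moreover have "f (u m) \<in> T (Suc n)" using u(1)[of m] mono[of "Suc n" "Suc m"] that
      by (auto simp: T_Suc)
    ultimately have "f (u n) + (u m - f (u m)) \<in> T (Suc n)"
      using T[of "Suc n"] by (auto intro: subspace_add subspace_diff)
    from u(3)[OF this] show ?thesis by (simp add: f_def)
  qed
  have "bounded (range u)" using u(2) by (auto simp: bounded_iff)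
  then obtain r l where r: "strict_mono r" "(\<lambda>n. K (u (r n))) \<longlonglongrightarrow> l"
    by (rule compact_op_subseq[OF K])
  then obtain n0 where "\<forall>m\<ge>n0. \<forall>n\<ge>n0. norm (K (u (r m)) - K (u (r n))) < 1 / 2"
    using CauchyD[OF LIMSEQ_imp_Cauchy[OF r(2)], of "1 / 2"] by auto
  then have "norm (K (u (r n0)) - K (u (r (Suc n0)))) < 1 / 2" by simp
  moreover have "r n0 < r (Suc n0)" using r(1) by (simp add: strict_mono_def)
  ultimately show False using sep by fastforce
qed

text \<open>
  Compactness lets one pass to the limit in \<open>y = x - K x\<close> if the preimages \<open>x\<close> can be kept bounded.
  This is possible after subtracting an almost nearest point of the kernel: otherwise suitably
  normalised preimages would accumulate at a point of the kernel, from which they stay away.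
\<close>

lemma closed_range_compact_perturbation:
  fixes K :: "'a::real_normed_vector \<Rightarrow> 'a"
  assumes K: "compact_op K"
  shows "closed (range (\<lambda>x. x - K x))"
proof -
  interpret K: bounded_linear K by (rule compact_op_bounded_linear[OF K])
  define f where "f x = x - K x" for x
  have f: "bounded_linear f" unfolding f_def
    by (intro bounded_linear_sub bounded_linear_ident K.bounded_linear_axioms)
  interpret f: bounded_linear f by (rule f)
  define N where "N = {x. f x = 0}"
  have N: "subspace N" unfolding N_def by (intro linear_subspace_kernel f.linear_axioms)
  have clN: "closed N" unfolding N_def
    using f by (intro closed_Collect_eq continuous_intros linear_continuous_on) auto
  have ne: "N \<noteq> {}" using subspace_0[OF N] by auto
  (* Along a subsequence on which K w converges, w itself converges, since w = f w + K w. *)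
  have lim: "\<exists>l. (\<lambda>n. w (s n)) \<longlonglongrightarrow> l \<and> f l = y"
    if s: "strict_mono s" and fw: "(\<lambda>n. f (w n)) \<longlonglongrightarrow> y" and Kw: "(\<lambda>n. K (w (s n))) \<longlonglongrightarrow> k"
    for w :: "nat \<Rightarrow> 'a" and s y k
  proof -
    have fs: "(\<lambda>n. f (w (s n))) \<longlonglongrightarrow> y" using LIMSEQ_subseq_LIMSEQ[OF fw s] by (simp add: o_def)
    from tendsto_add[OF this Kw] have ws: "(\<lambda>n. w (s n)) \<longlonglongrightarrow> y + k" by (simp add: f_def)
    moreover have "f (y + k) = y" using LIMSEQ_unique[OF f.tendsto[OF ws] fs] .
    ultimately show ?thesis by blast
  qed
  have "\<exists>C. \<forall>x. \<exists>x'. f x' = f x \<and> norm x' \<le> C * norm (f x)"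
  proof (rule ccontr)
    assume "\<not> ?thesis"
    then have "\<forall>n::nat. \<exists>x. \<forall>x'. f x' = f x \<longrightarrow> Suc n * norm (f x) < norm x'"
      by (metis not_le)
    then obtain x where x: "\<And>n x'. f x' = f (x n) \<Longrightarrow> Suc n * norm (f (x n)) < norm x'" by metis
    have "\<exists>w. norm w \<le> 2 \<and> norm (f w) \<le> 1 / Suc n \<and> (\<forall>m\<in>N. 1 \<le> norm (w - m))" for n
    proof -
      define d where "d = infdist (x n) N"
      have "x n \<notin> N" using x[of 0 n] by (auto simp: N_def f.zero)
      then obtain m where d: "0 < d" and m: "m \<in> N" "norm (x n - m) < 2 * d"
        using almost_nearest_point[OF clN ne, of "x n"] by (auto simp: dist_norm d_def)
      have "Suc n * norm (f (x n)) \<le> d" unfolding d_def infdist_notempty[OF ne]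
      proof (rule cINF_greatest[OF ne])
        fix m assume "m \<in> N"
        then have "f (x n - m) = f (x n)" by (simp add: N_def f.diff)
        then show "Suc n * norm (f (x n)) \<le> dist (x n) m" using x by (simp add: dist_norm less_imp_le)
      qed
      then have fd: "norm (f (x n)) / d \<le> 1 / Suc n" using d by (simp add: field_simps)
      define w where "w = (1 / d) *\<^sub>R (x n - m)"
      have "norm w = norm (x n - m) / d" using d by (simp only: w_def norm_scaleR) simp
      then have "norm w \<le> 2" using m d by (simp add: pos_divide_le_eq)
      moreover have "norm (f w) \<le> 1 / Suc n"
        using fd m d by (simp add: w_def f.scaleR f.diff N_def)
      moreover have "1 \<le> norm (w - v)" if "v \<in> N" for v
      proof -
        have "m + d *\<^sub>R v \<in> N" using that N m(1) by (simp add: subspace_add subspace_scale)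
        then have "d \<le> norm (x n - (m + d *\<^sub>R v))"
          using infdist_le[of "m + d *\<^sub>R v" N "x n"] by (simp add: d_def dist_norm)
        also have "x n - (m + d *\<^sub>R v) = d *\<^sub>R (w - v)" using d by (simp add: w_def algebra_simps)
        finally show ?thesis using d by simp
      qed
      ultimately show ?thesis by blast
    qed
    then obtain w where w: "\<And>n. norm (w n) \<le> 2" "\<And>n. norm (f (w n)) \<le> 1 / Suc n"
      "\<And>n m. m \<in> N \<Longrightarrow> 1 \<le> norm (w n - m)" by metis
    have "bounded (range w)" using w(1) by (auto simp: bounded_iff)
    then obtain s k where s: "strict_mono s" "(\<lambda>n. K (w (s n))) \<longlonglongrightarrow> k"
      by (rule compact_op_subseq[OF K])
    have "(\<lambda>n. f (w n)) \<longlonglongrightarrow> 0"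
      by (rule Lim_null_comparison[OF _ LIMSEQ_inverse_real_of_nat])
        (use w(2) in \<open>auto simp: inverse_eq_divide\<close>)
    then obtain l where l: "(\<lambda>n. w (s n)) \<longlonglongrightarrow> l" "f l = 0" using lim s by blast
    then obtain n where "norm (w (s n) - l) < 1"
      using LIMSEQ_D[OF l(1), of 1] by auto
    then show False using w(3)[of l "s n"] l(2) by (simp add: N_def)
  qed
  then obtain C g where g: "\<And>x. f (g x) = f x" "\<And>x. norm (g x) \<le> C * norm (f x)" by metis
  have "closed (range f)"
  proof (subst closed_sequential_limits, intro allI impI, elim conjE)
    fix y l assume y: "\<forall>n. y n \<in> range f" "y \<longlonglongrightarrow> l"
    then obtain x where x: "\<And>n. y n = f (x n)" unfolding image_iff by metis
    obtain b where b: "\<And>n. norm (y n) \<le> b"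
      using Bseq_def convergent_imp_Bseq[OF convergentI[OF y(2)]] by blast
    have "bounded (range (\<lambda>n. g (x n)))"
      unfolding bounded_iff
    proof (intro exI ballI)
      fix z assume "z \<in> range (\<lambda>n. g (x n))"
      then obtain n where n: "z = g (x n)" by auto
      have "norm z \<le> C * norm (y n)" unfolding n x by (rule g)
      also have "\<dots> \<le> \<bar>C\<bar> * b" using b[of n] by (intro mult_mono) auto
      finally show "norm z \<le> \<bar>C\<bar> * b" .
    qed
    then obtain s k where s: "strict_mono s" "(\<lambda>n. K (g (x (s n)))) \<longlonglongrightarrow> k"
      by (rule compact_op_subseq[OF K])
    moreover have "(\<lambda>n. f (g (x n))) \<longlonglongrightarrow> l" using y(2) by (simp add: g(1) flip: x)
    ultimately obtain v where "f v = l" using lim[of s "\<lambda>n. g (x n)"] by blast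
    then show "l \<in> range f" by auto
  qed
  then show ?thesis by (simp add: f_def)
qed

text \<open>
  The closed unit ball of the fixed space is compact, hence covered by finitely many balls of radius
  \<open>1 / 2\<close> around points of it. By Riesz's lemma the centres span the space.
\<close>

lemma finite_dimensional_fixed_points:
  fixes K :: "'a::real_normed_vector \<Rightarrow> 'a"
  assumes K: "compact_op K"
  shows "finite_dimensional {x. x - K x = 0}"
proof -
  interpret K: bounded_linear K by (rule compact_op_bounded_linear[OF K])
  define N where "N = {x. x - K x = 0}"
  have f: "bounded_linear (\<lambda>x. x - K x)"
    by (intro bounded_linear_sub bounded_linear_ident K.bounded_linear_axioms)
  have N: "subspace N" unfolding N_def
    using linear_subspace_kernel[OF bounded_linear.linear[OF f]] .
  have clN: "closed N" unfolding N_def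
    using f by (intro closed_Collect_eq continuous_intros linear_continuous_on K.bounded_linear_axioms) auto
  have "seq_compact (N \<inter> cball 0 1)"
  proof (rule seq_compactI)
    fix x :: "nat \<Rightarrow> 'a" assume x: "\<forall>n. x n \<in> N \<inter> cball 0 1"
    then have "bounded (range x)" by (auto simp: bounded_iff)
    then obtain r l where r: "strict_mono r" "(\<lambda>n. K (x (r n))) \<longlonglongrightarrow> l"
      by (rule compact_op_subseq[OF K])
    have "K (x n) = x n" for n using x by (auto simp: N_def)
    with r have xl: "(x \<circ> r) \<longlonglongrightarrow> l" by (simp add: o_def)
    have "l \<in> N \<inter> cball 0 1"
      by (rule closed_sequentially[OF closed_Int[OF clN closed_cball] _ xl]) (use x in auto)
    then show "\<exists>l\<in>N \<inter> cball 0 1. \<exists>r. strict_mono r \<and> (x \<circ> r) \<longlonglongrightarrow> l" using r xl by blast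
  qed
  then have "compact (N \<inter> cball 0 1)" by (simp add: compact_eq_seq_compact_metric)
  then obtain F where F: "finite F" "F \<subseteq> N \<inter> cball 0 1" "N \<inter> cball 0 1 \<subseteq> (\<Union>x\<in>F. ball x (1 / 2))"
    using compactE_image[of "N \<inter> cball 0 1" "N \<inter> cball 0 1" "\<lambda>x. ball x (1 / 2)"]
    by (metis (no_types, lifting) UN_I centre_in_ball half_gt_zero open_ball subsetI zero_less_one)
  have FN: "span F \<subseteq> N" using F N by (intro span_minimal) auto
  have "span F = N"
  proof (rule ccontr)
    assume "span F \<noteq> N"
    then obtain x where "x \<in> N" "x \<notin> span F" using FN by blast
    then obtain u where u: "u \<in> N" "norm u = 1" "\<And>m. m \<in> span F \<Longrightarrow> 1 / 2 \<le> norm (u - m)"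
      using riesz_almost_orthogonal[OF closed_span_finite[OF F(1)] subspace_span N FN] by blast
    then obtain v where "v \<in> F" "norm (u - v) < 1 / 2" using F(3)
      by (fastforce simp: dist_norm norm_minus_commute)
    then show False using u(3)[of v] by (simp add: span_base)
  qed
  then show ?thesis using F(1) unfolding finite_dimensional_def N_def by blast
qed

section \<open>Operators with compact resolvent that are symmetric for a pulled-back inner product\<close>

text \<open>
  The operator \<open>R\<close> is the inverse of \<open>\<mu>\<^sub>0 I - A\<close>. The inner product of the target of \<open>i\<close> is pulled
  back to a positive definite form for which \<open>A\<close> and \<open>R\<close> are symmetric. Since \<open>i\<close> need not be
  continuous, this form is unrelated to the topology of \<open>'a\<close>: closedness of orthogonal complements
  has to come from the compactness of \<open>R\<close>.
\<close>

locale symmetric_compact_resolvent =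
  fixes D :: "'a::banach set" and A :: "'a \<Rightarrow> 'a" and i :: "'a \<Rightarrow> 'b::real_inner"
    and \<mu>\<^sub>0 :: real and R :: "'a \<Rightarrow> 'a"
  assumes linear_A: "linear_operator D A"
    and linear_i: "linear i" and inj_i: "inj i"
    and symmetric: "\<And>x y. x \<in> D \<Longrightarrow> y \<in> D \<Longrightarrow> inner (i (A x)) (i y) = inner (i x) (i (A y))"
    and compact_R: "compact_op R"
    and R_mem: "\<And>y. R y \<in> D"
    and R_right: "\<And>y. \<mu>\<^sub>0 *\<^sub>R R y - A (R y) = y"
    and R_left: "\<And>x. x \<in> D \<Longrightarrow> R (\<mu>\<^sub>0 *\<^sub>R x - A x) = x"
begin

abbreviation form :: "'a \<Rightarrow> 'a \<Rightarrow> real" where "form x y \<equiv> inner (i x) (i y)"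

abbreviation eig :: "real \<Rightarrow> 'a set" where "eig \<equiv> eigenspace D A"

sublocale i: linear i by (rule linear_i)
sublocale R: bounded_linear R by (rule compact_op_bounded_linear[OF compact_R])

lemma subspace_D: "subspace D"
  and A_add: "x \<in> D \<Longrightarrow> y \<in> D \<Longrightarrow> A (x + y) = A x + A y"
  and A_scale: "x \<in> D \<Longrightarrow> A (c *\<^sub>R x) = c *\<^sub>R A x"
  using linear_A by (auto simp: linear_operator_def)

lemma A_zero: "A 0 = 0"
  using A_scale[of 0 0] subspace_0[OF subspace_D] by simp

lemma form_self_eq_0: "form x x = 0 \<Longrightarrow> x = 0"
  using inj_i by (simp add: linear_injective_0[OF linear_i])

lemma form_R: "form (R x) y = form x (R y)"
proof -
  have "form (R x) (\<mu>\<^sub>0 *\<^sub>R R y - A (R y)) = form (\<mu>\<^sub>0 *\<^sub>R R x - A (R x)) (R y)"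
    by (simp add: i.diff i.scale inner_diff_left inner_diff_right symmetric R_mem)
  then show ?thesis by (simp only: R_right)
qed

lemma eig_iff: "x \<in> eig \<nu> \<longleftrightarrow> x \<in> D \<and> A x = \<nu> *\<^sub>R x"
  by (auto simp: eigenspace_def)

text \<open>
  On \<open>D\<close> one has \<open>\<nu> I - A = (I - (\<mu>\<^sub>0 - \<nu>) R) (\<mu>\<^sub>0 I - A)\<close>, which turns eigenspaces of \<open>A\<close> into kernels
  of compact perturbations of the identity.
\<close>

lemma eig_iff_fixed_point: "x \<in> eig \<nu> \<longleftrightarrow> x - (\<mu>\<^sub>0 - \<nu>) *\<^sub>R R x = 0"
proof
  assume "x \<in> eig \<nu>"
  then show "x - (\<mu>\<^sub>0 - \<nu>) *\<^sub>R R x = 0"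
    using R_left[of x] by (simp add: eig_iff R.scaleR flip: scaleR_left_diff_distrib)
next
  assume "x - (\<mu>\<^sub>0 - \<nu>) *\<^sub>R R x = 0"
  then have x: "x = (\<mu>\<^sub>0 - \<nu>) *\<^sub>R R x" by simp
  have "x \<in> D" by (subst x) (intro subspace_scale subspace_D R_mem)
  moreover have "A x = (\<mu>\<^sub>0 - \<nu>) *\<^sub>R A (R x)" by (subst x) (simp add: A_scale R_mem)
  moreover have "A (R x) = \<mu>\<^sub>0 *\<^sub>R R x - x" using R_right[of x] by (simp add: algebra_simps)
  ultimately have "x \<in> D" "A x = \<mu>\<^sub>0 *\<^sub>R ((\<mu>\<^sub>0 - \<nu>) *\<^sub>R R x) - (\<mu>\<^sub>0 - \<nu>) *\<^sub>R x"
    by (simp_all add: scaleR_diff_right mult.commute)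
  then show "x \<in> eig \<nu>" using x by (simp add: eig_iff scaleR_left_diff_distrib)
qed

lemma subspace_eig: "subspace (eig \<nu>)"
  using subspace_D by (auto simp: subspace_def eig_iff A_add A_scale A_zero scaleR_add_right)

lemma compact_shift: "compact_op (\<lambda>x. (\<mu>\<^sub>0 - \<nu>) *\<^sub>R R x)"
  using compact_op_compose[OF compact_R bounded_linear_scaleR_right bounded_linear_ident] .

lemma finite_dimensional_eig: "finite_dimensional (eig \<nu>)"
proof -
  have "eig \<nu> = {x. x - (\<mu>\<^sub>0 - \<nu>) *\<^sub>R R x = 0}" using eig_iff_fixed_point by blast
  then show ?thesis using finite_dimensional_fixed_points[OF compact_shift[of \<nu>]] by simp
qed

lemma R_eig: "x \<in> eig \<nu> \<Longrightarrow> R x \<in> eig \<nu>"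
proof (unfold eig_iff_fixed_point)
  assume "x - (\<mu>\<^sub>0 - \<nu>) *\<^sub>R R x = 0"
  then have "R (x - (\<mu>\<^sub>0 - \<nu>) *\<^sub>R R x) = 0" by (simp add: R.zero)
  then show "R x - (\<mu>\<^sub>0 - \<nu>) *\<^sub>R R (R x) = 0" by (simp add: R.diff R.scaleR)
qed

lemma eig_orthogonal:
  assumes "x \<in> eig \<nu>" "y \<in> eig \<mu>" "\<nu> \<noteq> \<mu>"
  shows "form x y = 0"
  using symmetric[of x y] assms by (simp add: eig_iff i.scale)


section \<open>Orthogonal complements of eigenspaces\<close>

definition perp :: "real \<Rightarrow> 'a set" where
  "perp \<nu> = {x. \<forall>v\<in>eig \<nu>. form x v = 0}"

lemma subspace_perp: "subspace (perp \<nu>)"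
  by (auto simp: perp_def subspace_def i.zero i.add i.scale inner_add_left)

lemma eig_Int_perp: "x \<in> eig \<nu> \<Longrightarrow> x \<in> perp \<nu> \<Longrightarrow> x = 0"
  using form_self_eq_0 by (auto simp: perp_def)

lemma eig_perp: "x \<in> eig \<mu> \<Longrightarrow> \<mu> \<noteq> \<nu> \<Longrightarrow> x \<in> perp \<nu>"
  using eig_orthogonal by (auto simp: perp_def)

lemma R_perp: "x \<in> perp \<nu> \<Longrightarrow> R x \<in> perp \<nu>"
  by (auto simp: perp_def form_R R_eig)

lemma A_perp: "x \<in> perp \<nu> \<Longrightarrow> x \<in> D \<Longrightarrow> A x \<in> perp \<nu>"
  by (auto simp: perp_def symmetric eig_iff i.scale)

text \<open>
  By symmetry the range of \<open>f = I - (\<mu>\<^sub>0 - \<nu>) R\<close> is orthogonal to its kernel, the eigenspace, so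
  \<open>f\<close> is injective on its range. The range is closed and invariant, hence \<open>f\<close> maps it onto itself by the
  Fredholm alternative. Given \<open>x\<close>, this provides \<open>y\<close> in the range with \<open>f x = f y\<close>, and
  \<open>x = (x - y) + y\<close> is the required splitting. It also shows that the orthogonal complement is no
  larger than the range, which is why it is closed.
\<close>

lemma perp_eq_range: "perp \<nu> = range (\<lambda>x. x - (\<mu>\<^sub>0 - \<nu>) *\<^sub>R R x)" (is "_ = range ?f")
  and eig_perp_split: "\<exists>n\<in>eig \<nu>. x - n \<in> perp \<nu>"
proof -
  define f where "f = ?f"
  have f_diff: "f (x - y) = f x - f y" for x y
    by (simp add: f_def R.diff algebra_simps)
  have sub: "f x \<in> perp \<nu>" for x
  proof -
    have "form (f x) v = form x (f v)" for v
      by (simp add: f_def i.diff i.scale inner_diff_left inner_diff_right form_R)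
    then show ?thesis by (simp add: perp_def eig_iff_fixed_point f_def i.zero)
  qed
  have cl: "closed (range f)" unfolding f_def
    by (rule closed_range_compact_perturbation[OF compact_shift])
  have bl: "bounded_linear f" unfolding f_def
    by (intro bounded_linear_sub bounded_linear_ident compact_op_bounded_linear compact_shift)
  have ss: "subspace (range f)"
    using linear_subspace_image[OF bounded_linear.linear[OF bl] subspace_UNIV] .
  have inv: "(\<lambda>x. (\<mu>\<^sub>0 - \<nu>) *\<^sub>R R x) ` range f \<subseteq> range f"
  proof clarify
    fix x
    have "(\<mu>\<^sub>0 - \<nu>) *\<^sub>R R (f x) = f ((\<mu>\<^sub>0 - \<nu>) *\<^sub>R R x)"
      by (simp add: f_def R.diff R.scaleR scaleR_diff_right)
    then show "(\<mu>\<^sub>0 - \<nu>) *\<^sub>R R (f x) \<in> range f" by simp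
  qed
  have "f ` range f = range f" unfolding f_def
    using sub eig_Int_perp
    by (intro fredholm_alternative compact_shift cl[unfolded f_def] ss[unfolded f_def] inv[unfolded f_def])
      (auto simp: f_def eig_iff_fixed_point)
  then have split: "\<exists>n\<in>eig \<nu>. x - n \<in> range f" for x
  proof -
    assume "f ` range f = range f"
    then have "f x \<in> f ` range f" by blast
    then obtain y where y: "y \<in> range f" "f x = f y" by blast
    then have "x - y \<in> eig \<nu>" using f_diff[of x y] by (simp add: eig_iff_fixed_point f_def)
    then show ?thesis using y by (intro bexI[of _ "x - y"]) auto
  qed
  have range_sub: "range f \<subseteq> perp \<nu>" using sub by blast
  show "\<exists>n\<in>eig \<nu>. x - n \<in> perp \<nu>" using split[of x] range_sub by blast
  have "perp \<nu> \<subseteq> range f"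
  proof
    fix x assume x: "x \<in> perp \<nu>"
    obtain n where n: "n \<in> eig \<nu>" "x - n \<in> range f" using split by blast
    then have "x - n \<in> perp \<nu>" using range_sub by blast
    then have "x - (x - n) \<in> perp \<nu>" by (rule subspace_diff[OF subspace_perp x])
    then have "n = 0" using n(1) eig_Int_perp by simp
    then show "x \<in> range f" using n by simp
  qed
  then show "perp \<nu> = range ?f" using range_sub unfolding f_def by blast
qed

lemma closed_perp: "closed (perp \<nu>)"
  unfolding perp_eq_range by (rule closed_range_compact_perturbation[OF compact_shift])

section \<open>Discreteness of the eigenvalues\<close>

lemma eigenvalue_iff: "\<nu> \<in> eigenvalues D A \<longleftrightarrow> (\<exists>x\<in>eig \<nu>. x \<noteq> 0)"
  by (auto simp: eigenvalues_def eig_iff)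

text \<open>
  On the complement of the eigenspace of \<open>\<nu>\<close> the operator \<open>I - (\<mu>\<^sub>0 - \<nu>) R\<close> is bounded below. An
  eigenvector \<open>x\<close> for another eigenvalue \<open>\<mu>\<close> lies in this complement by orthogonality and is mapped to
  \<open>(\<nu> - \<mu>) R x\<close>, so \<open>\<mu>\<close> cannot be close to \<open>\<nu>\<close>.
\<close>

lemma not_islimpt_eigenvalues: "\<not> \<nu> islimpt eigenvalues D A"
proof -
  obtain c where c: "0 < c" "\<And>x. x \<in> perp \<nu> \<Longrightarrow> c * norm x \<le> norm (x - (\<mu>\<^sub>0 - \<nu>) *\<^sub>R R x)"
    using compact_perturbation_bounded_below[OF compact_shift closed_perp[of \<nu>] subspace_perp]
      eig_Int_perp eig_iff_fixed_point by metis
  obtain b where b: "0 < b" "\<And>x. norm (R x) \<le> norm x * b" using R.pos_bounded by blast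
  have "c / b \<le> dist \<mu> \<nu>" if "\<mu> \<in> eigenvalues D A" "\<mu> \<noteq> \<nu>" for \<mu>
  proof -
    obtain x where x: "x \<in> eig \<mu>" "x \<noteq> 0" using \<open>\<mu> \<in> _\<close> eigenvalue_iff by blast
    have "x = (\<mu>\<^sub>0 - \<mu>) *\<^sub>R R x" using x(1) by (simp add: eig_iff_fixed_point)
    then have "x - (\<mu>\<^sub>0 - \<nu>) *\<^sub>R R x = (\<mu>\<^sub>0 - \<mu>) *\<^sub>R R x - (\<mu>\<^sub>0 - \<nu>) *\<^sub>R R x" by simp
    also have "\<dots> = (\<nu> - \<mu>) *\<^sub>R R x" by (simp flip: scaleR_left_diff_distrib)
    finally have "norm (x - (\<mu>\<^sub>0 - \<nu>) *\<^sub>R R x) = dist \<mu> \<nu> * norm (R x)"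
      by (simp add: dist_real_def abs_minus_commute)
    then have "c * norm x \<le> dist \<mu> \<nu> * norm (R x)"
      using c(2) eig_perp[OF x(1) that(2)] by metis
    also have "\<dots> \<le> dist \<mu> \<nu> * (norm x * b)" by (intro mult_left_mono b) auto
    finally have "c \<le> dist \<mu> \<nu> * b" using x(2) by (simp add: mult.assoc mult.left_commute)
    then show ?thesis using b(1) by (simp add: pos_divide_le_eq)
  qed
  then show ?thesis using c(1) b(1) unfolding islimpt_approachable
    by (metis divide_pos_pos not_le)
qed

lemma finite_eigenvalues_le:
  assumes "\<And>\<mu>. \<mu> \<in> eigenvalues D A \<Longrightarrow> a \<le> \<mu>"
  shows "finite {\<mu>\<in>eigenvalues D A. \<mu> \<le> c}"
proof (rule ccontr)
  assume inf: "infinite {\<mu>\<in>eigenvalues D A. \<mu> \<le> c}"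
  have "{\<mu>\<in>eigenvalues D A. \<mu> \<le> c} \<subseteq> {a..c}" using assms by auto
  then obtain \<nu> where "\<nu> islimpt {\<mu>\<in>eigenvalues D A. \<mu> \<le> c}"
    using compact_Icc[of a c] inf unfolding compact_eq_Bolzano_Weierstrass by metis
  then have "\<nu> islimpt eigenvalues D A" by (rule islimpt_subset) auto
  then show False using not_islimpt_eigenvalues by blast
qed

section \<open>The spectrum of a part\<close>

text \<open>
  Symmetry forces the imaginary part of a complex eigenvalue to vanish; then the real or the imaginary
  part of the eigenvector is a real eigenvector.
\<close>

lemma complex_eigenvector:
  assumes S: "subspace S" and v: "v \<in> (D \<inter> S) \<times> (D \<inter> S)" "v \<noteq> 0" "shifted A z v = 0"
  shows "\<exists>\<nu>. z = of_real \<nu> \<and> (\<exists>x\<in>S. x \<noteq> 0 \<and> x \<in> eig \<nu>)"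
proof -
  obtain x y where xy: "v = (x, y)" "x \<in> D" "x \<in> S" "y \<in> D" "y \<in> S" using v(1) by auto
  have eq: "A x = Re z *\<^sub>R x - Im z *\<^sub>R y" "A y = Im z *\<^sub>R x + Re z *\<^sub>R y"
    using v(3) by (auto simp: xy(1) shifted_def cscale_def zero_prod_def)
  have "Im z * (form x x + form y y) = 0"
    using symmetric[OF xy(2,4)]
    by (simp add: eq i.diff i.add i.scale inner_diff_left inner_add_right algebra_simps inner_commute)
  moreover have "form x x + form y y \<noteq> 0"
    using v(2) form_self_eq_0[of x] form_self_eq_0[of y] inner_ge_zero[of "i x"] inner_ge_zero[of "i y"]
    by (auto simp: xy(1) zero_prod_def add_nonneg_eq_0_iff)
  ultimately have z: "Im z = 0" by simp
  then have "x \<in> eig (Re z)" "y \<in> eig (Re z)" using eq xy by (auto simp: eig_iff)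
  moreover have "z = of_real (Re z)" using z by (simp add: complex_eq_iff)
  ultimately show ?thesis using v(2) xy by (auto simp: zero_prod_def)
qed

text \<open>
  An \<open>R\<close>-invariant subspace reduces the resolvent: \<open>R\<close> restricted to \<open>S\<close> inverts \<open>\<mu>\<^sub>0 I - A\<close> on the
  domain of the part of \<open>A\<close> in \<open>S\<close>.
\<close>

lemma part_domain_eq_image:
  assumes S: "subspace S" and RS: "R ` S \<subseteq> S"
  shows "part_domain D A S = R ` S"
proof (intro equalityI subsetI)
  fix x assume "x \<in> part_domain D A S"
  then have "x \<in> D" "\<mu>\<^sub>0 *\<^sub>R x - A x \<in> S"
    using S by (auto simp: part_domain_def subspace_diff subspace_scale)
  then show "x \<in> R ` S" using R_left[of x] by force
next
  fix x assume "x \<in> R ` S"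
  then obtain y where y: "y \<in> S" "x = R y" by auto
  have "A x = \<mu>\<^sub>0 *\<^sub>R x - y" using R_right[of y] y by (simp add: algebra_simps)
  then show "x \<in> part_domain D A S"
    using y S RS R_mem by (auto simp: part_domain_def intro!: subspace_diff subspace_scale)
qed

lemma inj_R: "inj R"
  by (rule injI) (metis R_right)

lemma shifted_R:
  "shifted A z (map_prod R R w) = w - cscale (of_real \<mu>\<^sub>0 - z) (map_prod R R w)"
proof (cases w)
  case (Pair x y)
  have "A (R u) = \<mu>\<^sub>0 *\<^sub>R R u - u" for u using R_right[of u] by (simp add: algebra_simps)
  then show ?thesis by (simp add: Pair shifted_def cscale_def algebra_simps)
qed

text \<open>
  Composing \<open>z I - A\<close> with the complexified \<open>R\<close> gives \<open>I - K\<close> with \<open>K = (\<mu>\<^sub>0 - z) R\<close>, a compact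
  real-linear operator on the real Banach space \<open>'a \<times> 'a\<close>. The real Fredholm alternative therefore
  covers complex \<open>z\<close> as well, and the lower bound for \<open>I - K\<close> bounds the resolvent.
\<close>

lemma resolvent_set_partI:
  assumes S: "closed S" "subspace S" "R ` S \<subseteq> S"
    and inj: "\<And>v. v \<in> (D \<inter> S) \<times> (D \<inter> S) \<Longrightarrow> shifted A z v = 0 \<Longrightarrow> v = 0"
  shows "z \<in> resolvent_set S (part_domain D A S) A"
proof -
  define T where "T = map_prod R R"
  define K where "K w = cscale (of_real \<mu>\<^sub>0 - z) (T w)" for w
  have "bounded_linear (cscale (of_real \<mu>\<^sub>0 - z) :: 'a \<times> 'a \<Rightarrow> 'a \<times> 'a)"
    unfolding cscale_def [abs_def]
    by (intro bounded_linear_Pair bounded_linear_sub bounded_linear_add bounded_linear_fst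
        bounded_linear_snd bounded_linear_compose[OF bounded_linear_scaleR_right])
  then have K: "compact_op K" unfolding K_def T_def
    using compact_op_compose[OF compact_op_map_prod[OF compact_R] _ bounded_linear_ident] by blast
  have T: "compact_op T" unfolding T_def by (rule compact_op_map_prod[OF compact_R])
  have SS: "closed (S \<times> S)" "subspace (S \<times> S)"
    using S by (auto simp: closed_Times subspace_Times)
  have TS: "T ` (S \<times> S) = part_domain D A S \<times> part_domain D A S"
    using part_domain_eq_image[OF S(2,3)] by (auto simp: T_def)
  have KS: "K ` (S \<times> S) \<subseteq> S \<times> S"
    using S(2,3) by (auto simp: K_def T_def cscale_def intro!: subspace_diff subspace_add subspace_scale)
  have injK: "w = 0" if w: "w \<in> S \<times> S" "w - K w = 0" for w
  proof -
    have "T w \<in> (D \<inter> S) \<times> (D \<inter> S)" using w(1) S(3) R_mem by (auto simp: T_def image_subset_iff)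
    moreover have "shifted A z (T w) = 0" using w(2) by (simp add: T_def K_def shifted_R)
    ultimately have "T w = 0" by (rule inj)
    then have "K w = 0" by (simp add: K_def cscale_def zero_prod_def)
    then show ?thesis using w(2) by simp
  qed
  have surj: "(\<lambda>w. w - K w) ` (S \<times> S) = S \<times> S"
    by (rule fredholm_alternative[OF K SS KS injK])
  obtain c where c: "0 < c" "\<And>w. w \<in> S \<times> S \<Longrightarrow> c * norm w \<le> norm (w - K w)"
    using compact_perturbation_bounded_below[OF K SS injK] by blast
  have inj_T: "inj_on T (S \<times> S)" using inj_R by (auto simp: T_def inj_on_def dest: injD)
  have inj_f: "inj_on (\<lambda>w. w - K w) (S \<times> S)"
  proof (rule inj_onI)
    interpret K: bounded_linear K by (rule compact_op_bounded_linear[OF K])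
    fix u w assume uw: "u \<in> S \<times> S" "w \<in> S \<times> S" "u - K u = w - K w"
    have "(u - w) - K (u - w) = 0" using uw(3) by (simp add: K.diff algebra_simps)
    then show "u = w" using injK[of "u - w"] uw SS(2) by (simp add: subspace_diff)
  qed
  have sT: "shifted A z (T w) = w - K w" for w by (simp add: T_def K_def shifted_R)
  have "bij_betw (shifted A z \<circ> T) (S \<times> S) (S \<times> S)"
    using surj inj_f by (simp add: bij_betw_def o_def sT)
  moreover have "bij_betw T (S \<times> S) (part_domain D A S \<times> part_domain D A S)"
    using inj_T TS by (simp add: bij_betw_def)
  ultimately have bij: "bij_betw (shifted A z) (part_domain D A S \<times> part_domain D A S) (S \<times> S)"
    using bij_betw_comp_iff by blast
  obtain b where b: "0 < b" "\<And>w. norm (T w) \<le> norm w * b"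
    using bounded_linear.pos_bounded[OF compact_op_bounded_linear[OF T]] by blast
  have "cnorm (resolvent (part_domain D A S) A z w) \<le> (4 * b / c) * cnorm w" if "w \<in> S \<times> S" for w
  proof -
    obtain u where u: "u \<in> S \<times> S" "w = u - K u" using surj \<open>w \<in> _\<close> by blast
    have cu: "norm u \<le> norm w / c"
      using c(2)[OF u(1)] c(1) by (simp add: u(2) pos_le_divide_eq mult.commute)
    have "T u \<in> part_domain D A S \<times> part_domain D A S" using u(1) TS by blast
    then have "resolvent (part_domain D A S) A z w = T u"
      unfolding resolvent_def u(2) sT[symmetric]
      using bij by (intro inv_into_f_f) (auto simp: bij_betw_def)
    then have "cnorm (resolvent (part_domain D A S) A z w) \<le> 2 * norm (T u)"
      using cnorm_le_norm by metis
    also have "\<dots> \<le> 2 * (norm u * b)" using b(2)[of u] by simp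
    also have "\<dots> \<le> 2 * (norm w / c * b)"
      using cu b(1) by (intro mult_left_mono mult_right_mono) auto
    also have "\<dots> \<le> 2 * (2 * cnorm w / c * b)"
      using c(1) b(1) by (intro mult_left_mono mult_right_mono divide_right_mono norm_le_cnorm) auto
    finally show ?thesis by (simp add: mult_ac)
  qed
  with bij show ?thesis unfolding resolvent_set_def by blast
qed

lemma spectrum_part:
  assumes S: "closed S" "subspace S" "R ` S \<subseteq> S"
  shows "spectrum S (part_domain D A S) A = of_real ` {\<nu>. \<exists>x\<in>S. x \<noteq> 0 \<and> x \<in> eig \<nu>}"
proof (intro equalityI subsetI)
  fix z assume "z \<in> spectrum S (part_domain D A S) A"
  then obtain v where "v \<in> (D \<inter> S) \<times> (D \<inter> S)" "shifted A z v = 0" "v \<noteq> 0"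
    using resolvent_set_partI[OF S, of z] by (auto simp: spectrum_def)
  then show "z \<in> of_real ` {\<nu>. \<exists>x\<in>S. x \<noteq> 0 \<and> x \<in> eig \<nu>}"
    using complex_eigenvector[OF S(2)] by blast
next
  fix z :: complex assume "z \<in> of_real ` {\<nu>. \<exists>x\<in>S. x \<noteq> 0 \<and> x \<in> eig \<nu>}"
  then obtain \<nu> x where x: "z = of_real \<nu>" "x \<in> S" "x \<noteq> 0" "x \<in> D" "A x = \<nu> *\<^sub>R x"
    by (auto simp: eig_iff)
  then have dom: "(x, 0) \<in> part_domain D A S \<times> part_domain D A S"
      "(0, 0) \<in> part_domain D A S \<times> part_domain D A S"
    using S(2) subspace_D by (auto simp: part_domain_def A_zero subspace_0 subspace_scale)
  moreover have "shifted A z (x, 0) = shifted A z (0, 0)"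
    using x by (simp add: shifted_def cscale_def A_zero)
  ultimately have "\<not> inj_on (shifted A z) (part_domain D A S \<times> part_domain D A S)"
    using x(3) by (metis inj_onD prod.inject)
  then show "z \<in> spectrum S (part_domain D A S) A"
    by (auto simp: spectrum_def resolvent_set_def bij_betw_def)
qed

end

section \<open>Enumeration of the eigenvalues\<close>

text \<open>
  The inverse sends \<open>\<mu>\<close> to the number of elements of \<open>E\<close> up to \<open>\<mu>\<close>. It attains every admissible index,
  because each element of \<open>E\<close> that is not the largest has an immediate successor.
\<close>

lemma nth_smallest_bij:
  fixes E :: "real set"
  assumes fin: "\<And>c. finite {\<nu>\<in>E. \<nu> \<le> c}"
  shows "bij_betw (nth_smallest E) {j. 1 \<le> j \<and> (finite E \<longrightarrow> j \<le> card E)} E"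
proof -
  define J where "J = {j. 1 \<le> j \<and> (finite E \<longrightarrow> j \<le> card E)}"
  define r where "r \<mu> = card {\<nu>\<in>E. \<nu> < \<mu>} + 1" for \<mu>
  have fin': "finite {\<nu>\<in>E. \<nu> < \<mu>}" for \<mu>
    by (rule finite_subset[OF _ fin[of \<mu>]]) auto
  have r_card: "r \<mu> = card {\<nu>\<in>E. \<nu> \<le> \<mu>}" if "\<mu> \<in> E" for \<mu>
  proof -
    have "{\<nu>\<in>E. \<nu> \<le> \<mu>} = insert \<mu> {\<nu>\<in>E. \<nu> < \<mu>}" using that by auto
    then show ?thesis using fin'[of \<mu>] by (simp add: r_def)
  qed
  have nth_r: "nth_smallest E (r \<mu>) = \<mu>" if "\<mu> \<in> E" for \<mu>
    using that fin' by (intro nth_smallest_eqI) (auto simp: r_def)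
  have r_J: "r \<mu> \<in> J" if "\<mu> \<in> E" for \<mu>
    using r_card[OF that] card_mono[of E "{\<nu>\<in>E. \<nu> \<le> \<mu>}"] by (auto simp: J_def r_def)
  have least: "\<exists>m\<in>E. c < m \<and> {\<nu>\<in>E. \<nu> < m} = {\<nu>\<in>E. \<nu> \<le> c}" if x: "x \<in> E" "c < x" for c x
  proof -
    define F where "F = {\<nu>\<in>E. \<nu> \<le> x} \<inter> {c<..}"
    have F: "finite F" "x \<in> F" using fin x by (auto simp: F_def)
    then have "Min F \<in> F" "\<And>y. y \<in> F \<Longrightarrow> Min F \<le> y" using Min_in by auto
    then show ?thesis by (intro bexI[of _ "Min F"]) (force simp: F_def)+
  qed
  have surj: "\<exists>\<mu>\<in>E. r \<mu> = j" if "j \<in> J" for j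
    using that
  proof (induction j)
    case 0
    then show ?case by (simp add: J_def)
  next
    case (Suc j)
    show ?case
    proof (cases "j = 0")
      case True
      then have "E \<noteq> {}" using Suc.prems by (auto simp: J_def)
      then obtain y where y: "y \<in> E" by blast
      define F where "F = {\<nu>\<in>E. \<nu> \<le> y}"
      have F: "finite F" "y \<in> F" using fin y by (auto simp: F_def)
      then have m: "Min F \<in> F" "\<And>y. y \<in> F \<Longrightarrow> Min F \<le> y" using Min_in by auto
      then have empty: "{\<nu>\<in>E. \<nu> < Min F} = {}" by (force simp: F_def)
      have "r (Min F) = Suc j" unfolding r_def empty by (simp add: True)
      then show ?thesis using m(1) by (auto simp: F_def)
    next
      case False
      then have "j \<in> J" using Suc.prems by (auto simp: J_def)
      then obtain \<mu> where \<mu>: "\<mu> \<in> E" "r \<mu> = j" using Suc.IH by blast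
      have "\<exists>x\<in>E. \<mu> < x"
      proof (rule ccontr)
        assume "\<not> ?thesis"
        then have "{\<nu>\<in>E. \<nu> \<le> \<mu>} = E" by force
        then have "finite E" "card E = j" using fin[of \<mu>] r_card \<mu> by auto
        then show False using Suc.prems by (simp add: J_def)
      qed
      then obtain m where "m \<in> E" "{\<nu>\<in>E. \<nu> < m} = {\<nu>\<in>E. \<nu> \<le> \<mu>}" using least by blast
      then have "r m = Suc j" using r_card \<mu> by (simp add: r_def)
      then show ?thesis using \<open>m \<in> E\<close> by blast
    qed
  qed
  have "bij_betw (nth_smallest E) J E"
  proof (rule bij_betw_byWitness[where f' = r])
    show "\<forall>j\<in>J. r (nth_smallest E j) = j" "nth_smallest E ` J \<subseteq> E"
      using surj nth_r by force+
  qed (use nth_r r_J in auto)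
  then show ?thesis by (simp add: J_def)
qed

section \<open>Sums of eigenspaces and their orthogonal complements\<close>

context symmetric_compact_resolvent
begin

lemma form_sum_eig:
  assumes I: "finite I" "inj_on l I" and v: "\<And>m. m \<in> I \<Longrightarrow> v m \<in> eig (l m)"
    and j: "j \<in> I" and y: "y \<in> eig (l j)"
  shows "form (\<Sum>m\<in>I. v m) y = form (v j) y"
proof -
  have "form (v m) y = 0" if "m \<in> I - {j}" for m
    using eig_orthogonal[OF v y] that I(2) j by (auto simp: inj_on_def)
  then have "(\<Sum>m\<in>I - {j}. form (v m) y) = 0" by (intro sum.neutral) blast
  moreover have "form (\<Sum>m\<in>I. v m) y = (\<Sum>m\<in>I. form (v m) y)"
    by (simp add: i.sum inner_sum_left)
  ultimately show ?thesis using sum.remove[OF I(1) j, of "\<lambda>m. form (v m) y"] by simp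
qed

lemma eig_independent:
  assumes I: "finite I" "inj_on l I" and v: "\<And>m. m \<in> I \<Longrightarrow> v m \<in> eig (l m)"
    and sum: "(\<Sum>m\<in>I. v m) = 0" and j: "j \<in> I"
  shows "v j = 0"
  using form_sum_eig[OF I v j v[OF j]] sum by (intro form_self_eq_0) (simp add: i.zero)

text \<open>
  The projections onto the single eigenspaces add up, because different eigenspaces are orthogonal.
\<close>

lemma eig_decomposition:
  assumes I: "finite I" "inj_on l I"
  shows "\<exists>v\<in>Pi\<^sub>E I (\<lambda>j. eig (l j)). \<forall>j\<in>I. x - (\<Sum>m\<in>I. v m) \<in> perp (l j)"
proof -
  obtain P where P: "\<And>\<nu>. P \<nu> \<in> eig \<nu>" "\<And>\<nu>. x - P \<nu> \<in> perp \<nu>"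
    using eig_perp_split[where x = x] by metis
  define v where "v = restrict (\<lambda>j. P (l j)) I"
  have "x - (\<Sum>m\<in>I. v m) \<in> perp (l j)" if j: "j \<in> I" for j
    unfolding perp_def
  proof clarify
    fix y assume y: "y \<in> eig (l j)"
    have "form (\<Sum>m\<in>I. v m) y = form (P (l j)) y"
      using form_sum_eig[OF I _ j y, of v] P(1) j by (simp add: v_def)
    moreover have "form (x - P (l j)) y = 0" using P(2) y by (simp add: perp_def)
    ultimately show "form (x - (\<Sum>m\<in>I. v m)) y = 0"
      by (simp add: i.diff inner_diff_left)
  qed
  then show ?thesis using P(1) by (intro bexI[of _ v]) (auto simp: v_def)
qed

definition eig_span :: "(nat \<Rightarrow> real) \<Rightarrow> nat set \<Rightarrow> 'a set" where
  "eig_span l I = span (\<Union>j\<in>I. eig (l j))"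

lemma eig_spanI: "j \<in> I \<Longrightarrow> x \<in> eig (l j) \<Longrightarrow> x \<in> eig_span l I"
  by (auto simp: eig_span_def intro: span_base)

lemma eig_span_least:
  assumes "subspace S" "\<And>j. j \<in> I \<Longrightarrow> eig (l j) \<subseteq> S"
  shows "eig_span l I \<subseteq> S"
  unfolding eig_span_def using assms by (intro span_minimal) auto

lemma subspace_eig_span: "subspace (eig_span l I)"
  by (simp add: eig_span_def)

lemma form_perp_eig_span:
  assumes x: "\<And>j. j \<in> I \<Longrightarrow> x \<in> perp (l j)" and y: "y \<in> eig_span l I"
  shows "form x y = 0"
proof -
  have "subspace {y. form x y = 0}"
    by (auto simp: subspace_def i.zero i.add i.scale inner_add_right)
  then have "eig_span l I \<subseteq> {y. form x y = 0}"
    by (rule eig_span_least) (use x in \<open>auto simp: perp_def\<close>)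
  then show ?thesis using y by blast
qed

lemma eig_span_in_D: "eig_span l I \<subseteq> D"
  by (intro eig_span_least subspace_D) (auto simp: eig_iff)

lemma A_eig_span: "A ` eig_span l I \<subseteq> eig_span l I"
proof -
  have "subspace {x \<in> D. A x \<in> eig_span l I}"
    using subspace_D subspace_eig_span[of l I]
    by (auto simp: subspace_def A_add A_scale A_zero)
  then have "eig_span l I \<subseteq> {x \<in> D. A x \<in> eig_span l I}"
  proof (rule eig_span_least)
    fix j assume j: "j \<in> I"
    show "eig (l j) \<subseteq> {x \<in> D. A x \<in> eig_span l I}"
      using eig_spanI[OF j] subspace_scale[OF subspace_eig_span] by (auto simp: eig_iff)
  qed
  then show ?thesis by blast
qed

lemma R_eig_span: "R ` eig_span l I \<subseteq> eig_span l I"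
proof -
  have "subspace {x. R x \<in> eig_span l I}"
    using subspace_eig_span[of l I] by (auto simp: subspace_def R.add R.scaleR R.zero)
  then have "eig_span l I \<subseteq> {x. R x \<in> eig_span l I}"
    by (rule eig_span_least) (auto intro: R_eig eig_spanI)
  then show ?thesis by blast
qed

lemma direct_sum_eig_span:
  assumes I: "finite I" "inj_on l I"
  shows "direct_sum I (\<lambda>j. eig (l j)) (eig_span l I)"
  unfolding direct_sum_def bij_betw_def
proof (intro conjI equalityI subsetI)
  show "inj_on (\<lambda>v. \<Sum>j\<in>I. v j) (\<Pi>\<^sub>E j\<in>I. eig (l j))"
  proof (rule inj_onI)
    fix v w assume vw: "v \<in> (\<Pi>\<^sub>E j\<in>I. eig (l j))" "w \<in> (\<Pi>\<^sub>E j\<in>I. eig (l j))"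
      and eq: "(\<Sum>j\<in>I. v j) = (\<Sum>j\<in>I. w j)"
    show "v = w"
    proof (rule PiE_ext[OF vw])
      fix j assume "j \<in> I"
      have "v j - w j = 0"
      proof (rule eig_independent[OF I _ _ \<open>j \<in> I\<close>])
        show "v m - w m \<in> eig (l m)" if "m \<in> I" for m
          using vw that by (auto intro!: subspace_diff subspace_eig)
        show "(\<Sum>m\<in>I. v m - w m) = 0" using eq by (simp add: sum_subtractf)
      qed
      then show "v j = w j" by simp
    qed
  qed
next
  fix x assume "x \<in> (\<lambda>v. \<Sum>j\<in>I. v j) ` (\<Pi>\<^sub>E j\<in>I. eig (l j))"
  then show "x \<in> eig_span l I"
    by (auto intro!: subspace_sum[OF subspace_eig_span] intro: eig_spanI)
next
  fix x assume x: "x \<in> eig_span l I"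
  obtain v where v: "v \<in> Pi\<^sub>E I (\<lambda>j. eig (l j))" "\<And>j. j \<in> I \<Longrightarrow> x - (\<Sum>m\<in>I. v m) \<in> perp (l j)"
    using eig_decomposition[OF I, of x] by blast
  have "(\<Sum>m\<in>I. v m) \<in> eig_span l I"
    using v(1) by (auto intro!: subspace_sum[OF subspace_eig_span] intro: eig_spanI)
  then have "x - (\<Sum>m\<in>I. v m) \<in> eig_span l I"
    using x by (intro subspace_diff subspace_eig_span)
  from form_perp_eig_span[OF v(2) this] have "x - (\<Sum>m\<in>I. v m) = 0"
    by (rule form_self_eq_0)
  then show "x \<in> (\<lambda>v. \<Sum>j\<in>I. v j) ` (\<Pi>\<^sub>E j\<in>I. eig (l j))" using v(1) by auto
qed

text \<open>
  Bases of the single eigenspaces are disjoint and together independent, by orthogonality. Their union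
  is therefore a basis of the span, which gives both its finite dimension and the dimension formula.
\<close>

lemma eig_span_basis:
  assumes I: "finite I" "inj_on l I"
  obtains B where "finite B" "independent B" "span B = eig_span l I"
    "card B = (\<Sum>j\<in>I. dim (eig (l j)))"
proof -
  have "\<exists>B. B \<subseteq> eig \<nu> \<and> independent B \<and> eig \<nu> \<subseteq> span B \<and> card B = dim (eig \<nu>) \<and> finite B" for \<nu>
  proof -
    obtain B where B: "B \<subseteq> eig \<nu>" "independent B" "eig \<nu> \<subseteq> span B" "card B = dim (eig \<nu>)"
      using basis_exists by blast
    obtain F where "finite F" "eig \<nu> = span F"
      using finite_dimensional_eig by (auto simp: finite_dimensional_def)
    then have "finite B" using independent_span_bound[of F B] B(1,2) by auto
    with B show ?thesis by blast
  qed
  then obtain B where B: "\<And>\<nu>. B \<nu> \<subseteq> eig \<nu>" "\<And>\<nu>. independent (B \<nu>)" "\<And>\<nu>. eig \<nu> \<subseteq> span (B \<nu>)"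
      "\<And>\<nu>. card (B \<nu>) = dim (eig \<nu>)" "\<And>\<nu>. finite (B \<nu>)" by metis
  define C where "C = (\<Union>j\<in>I. B (l j))"
  have disj: "B (l j) \<inter> B (l m) = {}" if "j \<in> I" "m \<in> I" "j \<noteq> m" for j m
  proof (rule ccontr)
    assume "B (l j) \<inter> B (l m) \<noteq> {}"
    then obtain x where x: "x \<in> B (l j)" "x \<in> B (l m)" by blast
    have "l j \<noteq> l m" using that I(2) by (auto simp: inj_on_def)
    then have "x = 0" using x B(1) eig_orthogonal form_self_eq_0 by blast
    then show False using x(1) B(2) dependent_zero by blast
  qed
  have finC: "finite C" using I B(5) by (auto simp: C_def)
  have "independent C"
  proof
    assume "dependent C"
    then obtain u v where uv: "v \<in> C" "u v \<noteq> 0" "(\<Sum>v\<in>C. u v *\<^sub>R v) = 0"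
      using dependent_finite[OF finC] by blast
    then obtain j where j: "j \<in> I" "v \<in> B (l j)" by (auto simp: C_def)
    have "(\<Sum>j\<in>I. \<Sum>v\<in>B (l j). u v *\<^sub>R v) = 0"
      using uv(3) disj I(1) B(5) unfolding C_def by (subst (asm) sum.UNION_disjoint) auto
    then have "(\<Sum>v\<in>B (l j). u v *\<^sub>R v) = 0"
      using eig_independent[OF I _ _ j(1), of "\<lambda>j. \<Sum>v\<in>B (l j). u v *\<^sub>R v"] B(1)
      by (auto intro!: subspace_sum subspace_scale subspace_eig)
    then show False using B(2) dependent_finite[OF B(5)] j(2) uv(2) by blast
  qed
  moreover have "span C = eig_span l I"
  proof
    show "span C \<subseteq> eig_span l I"
      using B(1) by (intro span_minimal subspace_eig_span) (auto simp: C_def intro: eig_spanI)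
    show "eig_span l I \<subseteq> span C"
    proof (rule eig_span_least)
      fix j assume "j \<in> I"
      then have "span (B (l j)) \<subseteq> span C" by (intro span_mono) (auto simp: C_def)
      then show "eig (l j) \<subseteq> span C" using B(3) by blast
    qed simp
  qed
  moreover have "card C = (\<Sum>j\<in>I. dim (eig (l j)))"
    unfolding C_def using I(1) B(4,5) disj by (subst card_UN_disjoint) auto
  ultimately show ?thesis using that finC by blast
qed

lemma
  assumes I: "finite I" "inj_on l I"
  shows closed_eig_span: "closed (eig_span l I)"
    and finite_dimensional_eig_span: "finite_dimensional (eig_span l I)"
    and dim_eig_span: "dim (eig_span l I) = (\<Sum>j\<in>I. dim (eig (l j)))"
proof -
  obtain B where B: "finite B" "independent B" "span B = eig_span l I"
      "card B = (\<Sum>j\<in>I. dim (eig (l j)))"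
    using eig_span_basis[OF I] .
  show "closed (eig_span l I)" using closed_span_finite[OF B(1)] B(3) by simp
  show "finite_dimensional (eig_span l I)" using B(1,3) by (auto simp: finite_dimensional_def)
  show "dim (eig_span l I) = (\<Sum>j\<in>I. dim (eig (l j)))"
    using B(2,3,4) by (metis dim_span_eq_card_independent)
qed

lemma spectrum_eig_span:
  assumes I: "finite I" "inj_on l I" and ev: "\<And>j. j \<in> I \<Longrightarrow> l j \<in> eigenvalues D A"
  shows "spectrum (eig_span l I) (part_domain D A (eig_span l I)) A = {of_real (l j) | j. j \<in> I}"
proof -
  have "{\<nu>. \<exists>x\<in>eig_span l I. x \<noteq> 0 \<and> x \<in> eig \<nu>} = l ` I"
  proof (intro equalityI subsetI)
    fix \<nu> assume "\<nu> \<in> {\<nu>. \<exists>x\<in>eig_span l I. x \<noteq> 0 \<and> x \<in> eig \<nu>}"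
    then obtain x where x: "x \<in> eig_span l I" "x \<noteq> 0" "x \<in> eig \<nu>" by blast
    show "\<nu> \<in> l ` I"
    proof (rule ccontr)
      assume "\<nu> \<notin> l ` I"
      then have "x \<in> perp (l j)" if "j \<in> I" for j using eig_perp[OF x(3)] that by blast
      from form_perp_eig_span[OF this x(1)] have "x = 0" by (rule form_self_eq_0)
      then show False using x(2) by blast
    qed
  next
    fix \<nu> assume "\<nu> \<in> l ` I"
    then obtain j where j: "j \<in> I" "\<nu> = l j" by blast
    then obtain x where "x \<in> eig \<nu>" "x \<noteq> 0" using ev eigenvalue_iff by blast
    then show "\<nu> \<in> {\<nu>. \<exists>x\<in>eig_span l I. x \<noteq> 0 \<and> x \<in> eig \<nu>}"
      using eig_spanI[OF j(1)] j(2) by blast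
  qed
  then show ?thesis
    using spectrum_part[OF closed_eig_span[OF I] subspace_eig_span R_eig_span] by auto
qed

definition perp_all :: "(nat \<Rightarrow> real) \<Rightarrow> nat set \<Rightarrow> 'a set" where
  "perp_all l I = (\<Inter>j\<in>I. perp (l j))"

lemma closed_perp_all: "closed (perp_all l I)"
  by (auto simp: perp_all_def closed_perp)

lemma subspace_perp_all: "subspace (perp_all l I)"
  by (auto simp: perp_all_def subspace_perp intro: subspace_Inter)

text \<open>
  An eigenvector for \<open>l j\<close> with \<open>j \<in> I\<close> cannot be orthogonal to itself, while eigenvectors for all other
  eigenvalues are orthogonal to the listed eigenspaces.
\<close>

lemma spectrum_perp_all:
  "spectrum (perp_all l I) (part_domain D A (perp_all l I)) A = of_real ` (eigenvalues D A - l ` I)"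
proof -
  have "{\<nu>. \<exists>x\<in>perp_all l I. x \<noteq> 0 \<and> x \<in> eig \<nu>} = eigenvalues D A - l ` I"
    using eig_perp eig_Int_perp by (fastforce simp: perp_all_def eigenvalue_iff)
  moreover have "R ` perp_all l I \<subseteq> perp_all l I" by (auto simp: perp_all_def R_perp)
  ultimately show ?thesis
    using spectrum_part[OF closed_perp_all subspace_perp_all] by simp
qed

text \<open>
  Uniqueness of the components is orthogonality: if \<open>a + b + c = 0\<close> with orthogonal summands, pairing
  with each summand shows that it vanishes.
\<close>

lemma direct_sum3_orthogonal:
  assumes sub: "subspace U" "subspace V" "subspace W"
    and UV: "\<And>u v. u \<in> U \<Longrightarrow> v \<in> V \<Longrightarrow> form u v = 0"
    and UW: "\<And>u w. u \<in> U \<Longrightarrow> w \<in> W \<Longrightarrow> form u w = 0"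
    and VW: "\<And>v w. v \<in> V \<Longrightarrow> w \<in> W \<Longrightarrow> form v w = 0"
    and all: "\<And>x. \<exists>u\<in>U. \<exists>v\<in>V. \<exists>w\<in>W. x = u + v + w"
  shows "direct_sum3 U V W UNIV"
  unfolding direct_sum3_def bij_betw_def
proof (intro conjI)
  show "inj_on (\<lambda>(u, v, w). u + v + w) (U \<times> V \<times> W)"
  proof (rule inj_onI)
    fix p q
    assume pq: "p \<in> U \<times> V \<times> W" "q \<in> U \<times> V \<times> W"
      "(\<lambda>(u, v, w). u + v + w) p = (\<lambda>(u, v, w). u + v + w) q"
    obtain u v w u' v' w' where p: "p = (u, v, w)" and q: "q = (u', v', w')"
      by (metis prod_cases3)
    have *: "u \<in> U" "v \<in> V" "w \<in> W" "u' \<in> U" "v' \<in> V" "w' \<in> W" "u + v + w = u' + v' + w'"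
      using pq by (auto simp: p q)
    define a b c where "a = u - u'" and "b = v - v'" and "c = w - w'"
    have abc: "a \<in> U" "b \<in> V" "c \<in> W" using * sub by (auto simp: a_def b_def c_def subspace_diff)
    have "a + b + c = 0" using *(7) by (simp add: a_def b_def c_def algebra_simps)
    then have "i a + i b + i c = 0" by (metis i.add i.zero)
    then have s: "inner (i a) h + inner (i b) h + inner (i c) h = 0" for h
      by (simp flip: inner_add_left)
    have "form a a = 0" "form b b = 0" "form c c = 0"
      using s[of "i a"] s[of "i b"] s[of "i c"] UV[OF abc(1,2)] UW[OF abc(1,3)] VW[OF abc(2,3)]
      by (simp_all add: inner_commute)
    then have "a = 0" "b = 0" "c = 0" using form_self_eq_0 by auto
    then show "p = q" by (simp add: p q a_def b_def c_def)
  qed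
  show "(\<lambda>(u, v, w). u + v + w) ` (U \<times> V \<times> W) = UNIV" using all by force
qed

end

section \<open>From sectorial operators to symmetric compact resolvents\<close>

text \<open>
  Real numbers below the vertex \<open>a\<close> of the sector lie in the resolvent set, because there the argument
  of \<open>z - a\<close> is \<open>\<pi>\<close>. The complexified resolvent at such a real point \<open>\<mu>\<^sub>0\<close> acts componentwise, so a
  real operator \<open>R\<close> can be read off from it and inherits boundedness and compactness. Moreover, no
  eigenvalue of \<open>A\<close> lies below \<open>a\<close>.
\<close>

lemma symmetric_compact_resolvent_of_sectorial:
  fixes D :: "'a::banach set" and i :: "'a \<Rightarrow> 'b::{real_inner, complete_space}"
  assumes sec: "sectorial D A" and comp: "compact_resolvents D A"
    and i: "linear i" "inj i" and sa: "self_adjoint Dhat Ahat"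
    and sub: "map_prod i i ` op_graph D A \<subseteq> op_graph Dhat Ahat"
  obtains \<mu>\<^sub>0 R where "symmetric_compact_resolvent D A i \<mu>\<^sub>0 R"
    "\<And>\<mu>. \<mu> \<in> eigenvalues D A \<Longrightarrow> \<mu>\<^sub>0 < \<mu>"
proof -
  have lin: "linear_operator D A" using sec by (simp add: sectorial_def)
  then have sD: "subspace D" by (simp add: linear_operator_def)
  then have D0: "0 \<in> D" by (rule subspace_0)
  have "A (0 *\<^sub>R 0) = 0 *\<^sub>R A 0" using lin D0 unfolding linear_operator_def by blast
  then have A0: "A 0 = 0" by simp
  obtain a where a: "\<And>x::real. x < a \<Longrightarrow> of_real x \<in> resolvent_set UNIV D A"
  proof -
    obtain \<phi> a :: real where pa: "0 < \<phi>" "\<phi> < pi / 2"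
      "\<And>z. z \<noteq> of_real a \<and> \<phi> \<le> \<bar>Arg (z - of_real a)\<bar> \<and> \<bar>Arg (z - of_real a)\<bar> \<le> pi
          \<Longrightarrow> z \<in> resolvent_set UNIV D A"
      using sec unfolding sectorial_def by blast
    have "of_real x \<in> resolvent_set UNIV D A" if "x < a" for x
    proof (rule pa(3))
      have "Arg (of_real x - of_real a) = pi"
        using that Arg_of_real[of "x - a"] by simp
      moreover have "\<phi> \<le> pi" using pa(1,2) by linarith
      ultimately show "of_real x \<noteq> complex_of_real a \<and> \<phi> \<le> \<bar>Arg (of_real x - of_real a)\<bar> \<and>
          \<bar>Arg (of_real x - of_real a)\<bar> \<le> pi"
        using that by simp
    qed
    then show ?thesis using that by blast
  qed
  (* Any real number below a would do. *)
  define \<mu>\<^sub>0 where "\<mu>\<^sub>0 = a - 1"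
  define z where "z = complex_of_real \<mu>\<^sub>0"
  have z: "z \<in> resolvent_set UNIV D A" unfolding z_def by (rule a) (simp add: \<mu>\<^sub>0_def)
  then have bij: "bij_betw (shifted A z) (D \<times> D) UNIV" by (simp add: resolvent_set_def)
  define g where "g x = \<mu>\<^sub>0 *\<^sub>R x - A x" for x
  have sh: "shifted A z (x, y) = (g x, g y)" for x y
    by (simp add: shifted_def cscale_def z_def g_def)
  have inj_g: "inj_on g D"
  proof (rule inj_onI)
    fix x y assume *: "x \<in> D" "y \<in> D" "g x = g y"
    then have "shifted A z (x, 0) = shifted A z (y, 0)" by (simp add: sh)
    from inj_onD[OF bij_betw_imp_inj_on[OF bij] this] show "x = y" using *(1,2) D0 by simp
  qed
  have surj_g: "g ` D = UNIV"
  proof -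
    have "y \<in> g ` D" for y
    proof -
      (* Any second component would do here. *)
      have "(y, y) \<in> shifted A z ` (D \<times> D)" using bij by (simp add: bij_betw_def)
      then show ?thesis by (auto simp: sh)
    qed
    then show ?thesis by blast
  qed
  define R where "R = inv_into D g"
  have R_mem: "R y \<in> D" and R_right: "g (R y) = y" for y
    using surj_g by (auto simp: R_def inv_into_into f_inv_into_f)
  have R_left: "R (g x) = x" if "x \<in> D" for x
    using that inj_g by (simp add: R_def inv_into_f_f)
  have res: "resolvent D A z (x, y) = (R x, R y)" for x y
  proof -
    have "(x, y) = shifted A z (R x, R y)" by (simp add: sh R_right)
    then show ?thesis unfolding resolvent_def
      using bij R_mem by (auto simp: bij_betw_def intro!: inv_into_f_f)
  qed
  have R_eqI: "R y = x" if "x \<in> D" "g x = y" for x y using R_left that by blast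
  have g_lin: "g (x + y) = g x + g y" "g (c *\<^sub>R x) = c *\<^sub>R g x" if "x \<in> D" "y \<in> D" for x y c
    using lin that by (auto simp: g_def linear_operator_def algebra_simps)
  have bl: "bounded_linear R"
  proof -
    obtain C where C: "\<And>w. cnorm (resolvent D A z w) \<le> C * cnorm w"
      using z unfolding resolvent_set_def by auto
    have C0: "norm (R x) \<le> norm x * (4 * \<bar>C\<bar>)" for x
    proof -
      have "norm (R x) \<le> norm (R x, R 0)" by (rule norm_fst_le)
      also have "\<dots> \<le> 2 * cnorm (resolvent D A z (x, 0))" unfolding res by (rule norm_le_cnorm)
      also have "\<dots> \<le> 2 * (\<bar>C\<bar> * cnorm (x, 0::'a))"
      proof -
        have "0 \<le> cnorm (x, 0::'a)" using norm_le_cnorm[of "(x, 0::'a)"] norm_ge_zero[of "(x, 0::'a)"] by linarith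
        then have "C * cnorm (x, 0::'a) \<le> \<bar>C\<bar> * cnorm (x, 0::'a)" by (intro mult_right_mono) auto
        then show ?thesis using C[of "(x, 0)"] by linarith
      qed
      also have "\<dots> \<le> 2 * (\<bar>C\<bar> * (2 * norm (x, 0::'a)))"
        by (intro mult_left_mono cnorm_le_norm) auto
      finally show ?thesis by (simp add: mult_ac norm_Pair)
    qed
    show ?thesis
    proof (rule bounded_linear_intro[OF _ _ C0])
      show "R (x + y) = R x + R y" for x y
        by (intro R_eqI) (auto simp: g_lin R_mem R_right intro!: subspace_add sD)
      show "R (c *\<^sub>R x) = c *\<^sub>R R x" for c x
        by (intro R_eqI) (auto simp: g_lin[OF R_mem R_mem] R_mem R_right intro!: subspace_scale sD)
    qed
  qed
  have "compact_op R"
  proof (rule compact_opI[OF bl])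
    define C where "C = closure (resolvent D A z ` {w. cnorm w \<le> 1})"
    have "compact C" using comp z by (simp add: compact_resolvents_def C_def)
    then show "compact (fst ` C)" by (intro compact_continuous_image continuous_intros)
    show "R ` cball 0 (1 / 2) \<subseteq> fst ` C"
    proof clarify
      fix x :: 'a assume "x \<in> cball 0 (1 / 2)"
      then have "cnorm (x, 0::'a) \<le> 1" using cnorm_le_norm[of "(x, 0::'a)"] by (simp add: norm_Pair)
      then have "(R x, R 0) \<in> C" unfolding C_def res[symmetric] by (intro closure_subset[THEN subsetD]) auto
      then show "R x \<in> fst ` C" by force
    qed
  qed simp
  have graph: "i x \<in> Dhat \<and> Ahat (i x) = i (A x)" if "x \<in> D" for x
  proof -
    have "(i x, i (A x)) \<in> op_graph Dhat Ahat" using sub that by (auto simp: op_graph_def)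
    then show ?thesis by (auto simp: op_graph_def)
  qed
  have sym: "inner (i (A x)) (i y) = inner (i x) (i (A y))" if "x \<in> D" "y \<in> D" for x y
  proof -
    have "(i y, Ahat (i y)) \<in> adjoint_graph Dhat Ahat"
      using sa graph[OF that(2)] by (auto simp: self_adjoint_def op_graph_def)
    then show ?thesis using graph[OF that(1)] graph[OF that(2)] by (auto simp: adjoint_graph_def)
  qed
  have "symmetric_compact_resolvent D A i \<mu>\<^sub>0 R"
    using lin i sym \<open>compact_op R\<close> R_mem R_right R_left
    by (intro symmetric_compact_resolvent.intro) (auto simp: g_def)
  moreover have "\<mu>\<^sub>0 < \<mu>" if "\<mu> \<in> eigenvalues D A" for \<mu>
  proof (rule ccontr)
    assume "\<not> \<mu>\<^sub>0 < \<mu>"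
    then have "bij_betw (shifted A (of_real \<mu>)) (D \<times> D) UNIV"
      using a[of \<mu>] by (simp add: resolvent_set_def \<mu>\<^sub>0_def)
    then have inj: "inj_on (shifted A (of_real \<mu>)) (D \<times> D)" by (rule bij_betw_imp_inj_on)
    from that obtain x where x: "x \<in> D" "x \<noteq> 0" "A x = \<mu> *\<^sub>R x" unfolding eigenvalues_def by blast
    have "shifted A (of_real \<mu>) (x, 0) = shifted A (of_real \<mu>) (0, 0)"
      using x(3) A0 by (simp add: shifted_def cscale_def)
    from inj_onD[OF inj this] show False using x(1,2) D0 by simp
  qed
  ultimately show ?thesis using that by blast
qed

section \<open>The spectral decomposition\<close>

theorem theorem2p3:
  fixes D :: "'a::banach set" and A :: "'a \<Rightarrow> 'a"
    and i :: "'a \<Rightarrow> 'b::{real_inner, complete_space}"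
    and Dhat :: "'b set" and Ahat :: "'b \<Rightarrow> 'b"
    and k :: nat and lam :: real and X0 :: "'a set"
  assumes "sectorial D A"
    and "compact_resolvents D A"
    and "linear i" and "inj i"
    and "self_adjoint Dhat Ahat"
    and "map_prod i i ` op_graph D A \<subseteq> op_graph Dhat Ahat"
    and "k \<in> eigenvalue_indices D A"
    and "lam = eigenvalue_nr D A k"
    and "X0 = eigenspace D A lam"
  shows "\<exists>Xp Xm.
      subspace Xp \<and> closed Xp \<and> subspace Xm \<and> closed Xm \<and> direct_sum3 Xp Xm X0 UNIV \<and>
      (Xm \<subseteq> D \<and> A ` Xm \<subseteq> Xm \<and> A ` (Xp \<inter> D) \<subseteq> Xp \<and> finite_dimensional Xm \<and>
       (k = 1 \<longrightarrow> Xm = {0}) \<and>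
       (2 \<le> k \<longrightarrow> direct_sum {1..k-1} (\<lambda>j. eigenspace D A (eigenvalue_nr D A j)) Xm) \<and>
       (k = 1 \<longrightarrow> dim Xm = 0) \<and>
       (2 \<le> k \<longrightarrow> dim Xm = (\<Sum>j = 1..k-1. dim (eigenspace D A (eigenvalue_nr D A j))))) \<and>
      (spectrum Xp (part_domain D A Xp) A =
         {of_real (eigenvalue_nr D A j) | j. j \<in> eigenvalue_indices D A \<and> k + 1 \<le> j} \<and>
       (k = 1 \<longrightarrow> spectrum Xm (part_domain D A Xm) A = {}) \<and>
       (2 \<le> k \<longrightarrow> spectrum Xm (part_domain D A Xm) A =
         {of_real (eigenvalue_nr D A j) | j. j \<in> {1..k-1}})) \<and>
      ((\<forall>u\<in>Xp. \<forall>v\<in>Xm. inner (i u) (i v) = 0) \<and>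
       (\<forall>u\<in>Xp. \<forall>v\<in>X0. inner (i u) (i v) = 0) \<and>
       (\<forall>u\<in>Xm. \<forall>v\<in>X0. inner (i u) (i v) = 0))"
proof -
  obtain \<mu>\<^sub>0 R where R: "symmetric_compact_resolvent D A i \<mu>\<^sub>0 R"
      "\<And>\<mu>. \<mu> \<in> eigenvalues D A \<Longrightarrow> \<mu>\<^sub>0 < \<mu>"
    using symmetric_compact_resolvent_of_sectorial[OF assms(1-6)] by blast
  interpret symmetric_compact_resolvent D A i \<mu>\<^sub>0 R by (rule R(1))
  define l where "l = eigenvalue_nr D A"
  define J where "J = eigenvalue_indices D A"
  define I where "I = {1..k - 1}"
  define Xp Xm where "Xp = perp_all l {1..k}" and "Xm = eig_span l I"
  have "finite {\<nu>\<in>eigenvalues D A. \<nu> \<le> c}" for c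
    by (rule finite_eigenvalues_le[of \<mu>\<^sub>0]) (use R(2) in force)
  from nth_smallest_bij[OF this] have l: "bij_betw l J (eigenvalues D A)"
    unfolding l_def J_def eigenvalue_nr_def[abs_def] eigenvalue_indices_def .
  have k: "{1..k} \<subseteq> J" "1 \<le> k" using assms(7) by (auto simp: J_def eigenvalue_indices_def)
  have ik: "{1..k} = insert k I" "k \<notin> I" using k(2) by (auto simp: I_def)
  have IJ: "I \<subseteq> J" using k ik by auto
  have inj: "inj_on l I" "inj_on l {1..k}" "inj_on l J"
    using bij_betw_imp_inj_on[OF l] IJ k(1) inj_on_subset by blast+
  have fin: "finite I" by (simp add: I_def)
  have X0: "X0 = eig (l k)" using assms(8,9) by (simp add: l_def)
  have ev: "l j \<in> eigenvalues D A" if "j \<in> I" for j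
    using l that IJ by (auto simp: bij_betw_def)
  have o1: "form u v = 0" if "u \<in> Xp" "v \<in> Xm" for u v
    using that ik by (intro form_perp_eig_span[of I u l]) (auto simp: Xp_def Xm_def perp_all_def)
  have o2: "form u v = 0" if "u \<in> Xp" "v \<in> X0" for u v
    using that ik by (auto simp: Xp_def X0 perp_all_def perp_def)
  have o3: "form u v = 0" if "u \<in> Xm" "v \<in> X0" for u v
  proof -
    have "v \<in> perp (l j)" if "j \<in> I" for j
      using \<open>v \<in> X0\<close> that ik inj(2) by (intro eig_perp[of v "l k"]) (auto simp: X0 inj_on_def)
    then have "form v u = 0" using \<open>u \<in> Xm\<close> by (intro form_perp_eig_span) (auto simp: Xm_def)
    then show ?thesis by (simp add: inner_commute)
  qed
  have ds: "direct_sum3 Xp Xm X0 UNIV"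
  proof (rule direct_sum3_orthogonal)
    show "subspace Xp" "subspace Xm" "subspace X0"
      by (simp_all add: Xp_def Xm_def X0 subspace_perp_all subspace_eig_span subspace_eig)
    fix x
    obtain v where v: "v \<in> Pi\<^sub>E {1..k} (\<lambda>j. eig (l j))"
        "\<And>j. j \<in> {1..k} \<Longrightarrow> x - (\<Sum>m\<in>{1..k}. v m) \<in> perp (l j)"
      using eig_decomposition[OF _ inj(2), of x] by auto
    have "x - (\<Sum>m\<in>{1..k}. v m) \<in> Xp" using v(2) by (simp add: Xp_def perp_all_def)
    moreover have "(\<Sum>m\<in>I. v m) \<in> Xm"
      using v(1) ik by (auto simp: Xm_def intro!: subspace_sum[OF subspace_eig_span] intro: eig_spanI)
    moreover have "v k \<in> X0" using v(1) k(2) by (auto simp: X0)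
    moreover have "x = (x - (\<Sum>m\<in>{1..k}. v m)) + (\<Sum>m\<in>I. v m) + v k"
      unfolding ik(1) using ik(2) fin by simp
    ultimately show "\<exists>u\<in>Xp. \<exists>v\<in>Xm. \<exists>w\<in>X0. x = u + v + w" by blast
  qed (use o1 o2 o3 in auto)
  have Ap: "A ` (Xp \<inter> D) \<subseteq> Xp" by (auto simp: Xp_def perp_all_def A_perp)
  have trivial: "I = {}" "Xm = {0}" if "k = 1"
    using that by (simp_all add: Xm_def I_def eig_span_def)
  have dim_Xm: "dim Xm = (\<Sum>j\<in>I. dim (eig (l j)))"
    unfolding Xm_def by (rule dim_eig_span[OF fin inj(1)])
  have "spectrum Xp (part_domain D A Xp) A = of_real ` (l ` J - l ` {1..k})"
    using spectrum_perp_all[of l "{1..k}"] l by (simp add: Xp_def bij_betw_def)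
  also have "l ` J - l ` {1..k} = l ` {j \<in> J. k + 1 \<le> j}"
  proof -
    have "J - {1..k} = {j \<in> J. k + 1 \<le> j}" by (auto simp: J_def eigenvalue_indices_def)
    then show ?thesis using inj_on_image_set_diff[OF inj(3) _ k(1), of J] by simp
  qed
  finally have sp: "spectrum Xp (part_domain D A Xp) A = {of_real (l j) | j. j \<in> J \<and> k + 1 \<le> j}"
    by auto
  have sm: "spectrum Xm (part_domain D A Xm) A = {of_real (l j) | j. j \<in> I}"
    unfolding Xm_def by (rule spectrum_eig_span[OF fin inj(1) ev])
  show ?thesis
    unfolding l_def[symmetric] J_def[symmetric] I_def[symmetric]
  proof (rule exI[of _ Xp], rule exI[of _ Xm], intro conjI ballI impI)
    show "subspace Xp" "closed Xp" by (simp_all add: Xp_def subspace_perp_all closed_perp_all)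
    show "subspace Xm" "closed Xm" "Xm \<subseteq> D" "A ` Xm \<subseteq> Xm" "finite_dimensional Xm"
      "direct_sum I (\<lambda>j. eig (l j)) Xm"
      unfolding Xm_def
      by (rule subspace_eig_span closed_eig_span[OF fin inj(1)] eig_span_in_D A_eig_span
          finite_dimensional_eig_span[OF fin inj(1)] direct_sum_eig_span[OF fin inj(1)])+
    show "dim Xm = 0" if "k = 1" using dim_Xm trivial(1)[OF that] by simp
    show "spectrum Xm (part_domain D A Xm) A = {}" if "k = 1" using sm trivial(1)[OF that] by simp
  qed (use ds Ap trivial(2) dim_Xm sp sm o1 o2 o3 in auto)
qed

end
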